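(* Let $X$ and $Y$ be finite metric spaces, endowed with functions $f\colon X\to\mathbb{R}$ and $g\colon Y\to\mathbb{R}$; write $X_f$ and $Y_g$ for these spaces equipped with their functions. Let $DF$ and $DG$ be the persistent discrete decorated Reeb graphs of $X_f$ and $Y_g$, respectively. Then $$d_{\mathrm{I}}(DF,DG)\leq d_{\mathrm{FD}}(X_f,Y_g).$$
   Context: Fix a field $k$; $\mathbf{Vec}$ is the category of $k$-vector spaces and linear maps, and homology $H_\bullet$ is taken with coefficients in $k$. $\mathcal{O}(\mathbb{R})$ is the poset category of open subsets of $\mathbb{R}$ ordered by inclusion. $\mathbf{Fun}(\mathbf{A},\mathbf{B})$ denotes the functor category. **Vietoris-Rips complex.** For a finite metric space $(X,d_X)$ and $r\in\mathbb{R}$, $VR(X,r)$ is the simplicial complex whose simplices are the (nonempty) subsets $\sigma\subseteq X$ with $d_X(x,x')\leq 2r$ for all $x,x'\in\sigma$. For $r\le s$ there is an inclusion $VR(X,r)\subseteq VR(X,s)$. **Category $\mathbf{PVec}$.** Objects are functors $\sigma\colon S\to\mathbf{Vec}$ where $S$ is a set regarded as a discrete category (i.e. families of vector spaces indexed by a set). A morphism from $\sigma\colon S\to\mathbf{Vec}$ to $\tau\colon T\to\mathbf{Vec}$ consists of a map of sets $\mu\colon S\to T$ and a natural transformation $\sigma\Rightarrow\tau\circ\mu$ (i.e. a linear map $\sigma(s)\to\tau(\mu(s))$ for each $s\in S$). **Persistent discrete decorated Reeb graph.** Given a finite metric space $X$ with $f\colon X\to\mathbb{R}$, for open $U\subseteq\mathbb{R}$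 let $f_r^{-1}(U)$ be the full subcomplex of $VR(X,r)$ on all vertices $x\in f^{-1}(U)$. The persistent discrete decorated Reeb graph of $X_f$ is the functor $$DF\colon(\mathbb{R}^2,\leq)\to\mathbf{Fun}(\mathcal{O}(\mathbb{R}),\mathbf{PVec}),\qquad (r,s)\mapsto\mathcal{F}(r,s),$$ where $\leq$ on $\mathbb{R}^2$ is the product order and $\mathcal{F}(r,s)(U)$ is the object of $\mathbf{PVec}$ indexed by the set $\pi_0(f_r^{-1}(U))$ of connected components, assigning to a component $A$ the vector space $H_\bullet(VR(A,s))$. Here, in $VR(A,s)$, $A$ is regarded as a finite metric space, namely the set of vertices of the component with the metric restricted from $X$. For $r\le r'$, $s\le s'$, $U\subseteq V$, the structure morphisms send a component $A$ of $f_r^{-1}(U)$ to the component $A'$ of $f_{r'}^{-1}(V)$ containing it, together with the linear map $H_\bullet(VR(A,s))\to H_\bullet(VR(A',s'))$ induced by inclusion. $DG$ is defined in the same way from $Y_g$. **Smoothing and interleaving distance.** For $\epsilon>0$ and $U\in\mathcal{O}(\mathbb{R})$ let $U^\epsilon=\{t\in\mathbb{R}\mid\exists v\in U,\ |t-v|<\epsilon\}$, and $U^0=U$. The $\epsilon$-smoothing of $DF$ is $DF^\epsilon(r,s)(U)=DF(r+\epsilon,s+\epsilon)(U^\epsilon)$ (similarly for $DG$ and for morphisms), and $\eta^\epsilon_{DF}\colon DF\to DF^\epsilon$ is the natural transformation given by the structure morphisms of $DF$ for $(r,s)\le(r+\epsilon,s+\epsilon)$ and $U\subseteq U^\epsilon$.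 $DF$ and $DG$ are $\epsilon$-interleaved if there are natural transformations $\phi\colon DF\to DG^\epsilon$ and $\psi\colon DG\to DF^\epsilon$ with $\psi^\epsilon\circ\phi=\eta^{2\epsilon}_{DF}$ and $\phi^\epsilon\circ\psi=\eta^{2\epsilon}_{DG}$. The interleaving distance is $d_{\mathrm{I}}(DF,DG)=\inf\{\epsilon\ge 0\mid DF\text{ and }DG\text{ are }\epsilon\text{-interleaved}\}$. **Functional distortion distance.** For (not necessarily continuous) maps $\Phi\colon X\to Y$, $\Psi\colon Y\to X$, let $C(\Phi,\Psi)=\{(x,y)\in X\times Y\mid y=\Phi(x)\text{ or }x=\Psi(y)\}$ and $$\mathrm{dist}(\Phi,\Psi)=\sup\{|d_X(x,x')-d_Y(y,y')|\ \mid\ (x,y),(x',y')\in C(\Phi,\Psi)\}.$$ Set $$\mathrm{FunDist}(\Phi,\Psi)=\max\left\{\tfrac12\mathrm{dist}(\Phi,\Psi),\ \|f-g\circ\Phi\|_\infty,\ \|g-f\circ\Psi\|_\infty\right\},$$ and $d_{\mathrm{FD}}(X_f,Y_g)=\inf_{\Phi,\Psi}\mathrm{FunDist}(\Phi,\Psi)$, the infimum being over all pairs of maps $\Phi\colon X\to Y$, $\Psi\colon Y\to X$. *)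

theory Defs
  imports
    "HOL-Analysis.Abstract_Metric_Spaces"
    "HOL-Library.Extended_Nonnegative_Real"
    "HOL-Library.Product_Order"
    "HOL-Algebra.AbelCoset"
    "Jordan_Normal_Form.VS_Connect"
begin

section \<open>Constructions on vector spaces\<close>

text \<open>
  The ground field is a type of class \<^class>\<open>field\<close>, and \<^term>\<open>class_ring\<close> is the
  corresponding ring record, so that a vector space is a record \<^term>\<open>V\<close> with
  \<^term>\<open>vectorspace class_ring V\<close> and a linear map is a \<^term>\<open>T\<close> with
  \<^term>\<open>linear_map class_ring V W T\<close>. The record fields \<^const>\<open>mult\<close> and
  \<^const>\<open>one\<close> are not used by these notions and are left unspecified.
\<close>

definition quotient_space :: "('k, 'v) module \<Rightarrow> 'v set \<Rightarrow> ('k, 'v set) module" where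
  "quotient_space V W =
     \<lparr>carrier = a_rcosets\<^bsub>V\<^esub> W, mult = undefined, one = undefined,
      zero = W, add = (<+>\<^bsub>V\<^esub>),
      smult = (\<lambda>a A. \<Union>v\<in>A. W +>\<^bsub>V\<^esub> (a \<odot>\<^bsub>V\<^esub> v))\<rparr>"

definition direct_sum_space :: "(nat \<Rightarrow> ('k, 'v) module) \<Rightarrow> ('k, nat \<Rightarrow> 'v) module" where
  "direct_sum_space V =
     \<lparr>carrier = {h. (\<forall>n. h n \<in> carrier (V n)) \<and> finite {n. h n \<noteq> \<zero>\<^bsub>V n\<^esub>}},
      mult = undefined, one = undefined,
      zero = (\<lambda>n. \<zero>\<^bsub>V n\<^esub>), add = (\<lambda>g h n. g n \<oplus>\<^bsub>V n\<^esub> h n),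
      smult = (\<lambda>a h n. a \<odot>\<^bsub>V n\<^esub> h n)\<rparr>"


section \<open>Simplicial complexes and their homology\<close>

text \<open>A simplicial complex is given by its set of (nonempty) simplices.\<close>

definition vertices :: "'a set set \<Rightarrow> 'a set" where
  "vertices K = {x. {x} \<in> K}"

definition edges :: "'a set set \<Rightarrow> ('a \<times> 'a) set" where
  "edges K = {(x, y). {x, y} \<in> K}"

text \<open>
  A connected component is represented by its set of vertices. As \<^term>\<open>edges K\<close> contains
  the pairs \<open>(x, x)\<close> with \<open>x\<close> a vertex, its transitive closure is an equivalence relation on
  the vertices.
\<close>

definition pi0 :: "'a set set \<Rightarrow> 'a set set" where
  "pi0 K = vertices K // (edges K)\<^sup>+"

definition component_containing :: "'a set set \<Rightarrow> 'a set \<Rightarrow> 'a set" where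
  "component_containing L A = (THE B. B \<in> pi0 L \<and> A \<subseteq> B)"

definition full_subcomplex :: "'a set set \<Rightarrow> 'a set \<Rightarrow> 'a set set" where
  "full_subcomplex K W = {\<sigma> \<in> K. \<sigma> \<subseteq> W}"

text \<open>
  Oriented simplicial chains. An oriented \<open>n\<close>-simplex is given by an ordering
  \<open>[x\<^sub>0, \<dots>, x\<^sub>n]\<close> of its vertices, and exchanging two vertices reverses the orientation.
  An \<open>n\<close>-chain is a finitely supported function on oriented \<open>n\<close>-simplices that takes opposite
  values on opposite orientations; it is extended by 0 to all lists. For \<open>n \<ge> 1\<close> the elementary
  chain of \<open>[x\<^sub>0, \<dots>, x\<^sub>n]\<close> is thus the function with value the sign of \<open>p\<close> at
  \<open>[x\<^bsub>p 0\<^esub>, \<dots>, x\<^bsub>p n\<^esub>]\<close> and value 0 at all other lists.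
\<close>

definition oriented_chains :: "nat \<Rightarrow> 'a set set \<Rightarrow> ('a list \<Rightarrow> 'k::field) set" where
  "oriented_chains n K =
     {c. finite {xs. c xs \<noteq> 0} \<and>
         (\<forall>xs. c xs \<noteq> 0 \<longrightarrow> length xs = Suc n \<and> distinct xs \<and> set xs \<in> K) \<and>
         (\<forall>xs i j. i < j \<and> j < length xs \<longrightarrow> c (xs[i := xs ! j, j := xs ! i]) = - c xs)}"

definition chain_space :: "nat \<Rightarrow> 'a set set \<Rightarrow> ('k::field, 'a list \<Rightarrow> 'k) module" where
  "chain_space n K =
     \<lparr>carrier = oriented_chains n K, mult = undefined, one = undefined,
      zero = (\<lambda>_. 0), add = (\<lambda>c d xs. c xs + d xs), smult = (\<lambda>a c xs. a * c xs)\<rparr>"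

text \<open>
  The usual boundary
  \<open>\<partial>[x\<^sub>0, \<dots>, x\<^sub>n] = (\<Sum>i\<le>n. (-1)\<^sup>i [x\<^sub>0, \<dots>, x\<^bsub>i-1\<^esub>, x\<^bsub>i+1\<^esub>, \<dots>, x\<^sub>n])\<close>
  in terms of coefficients: \<open>[x, y\<^sub>1, \<dots>, y\<^sub>n]\<close> is the orientation of \<open>{x, y\<^sub>1, \<dots>, y\<^sub>n}\<close> in
  whose boundary \<open>[y\<^sub>1, \<dots>, y\<^sub>n]\<close> has coefficient 1. The boundary of a 0-chain is 0, that is,
  homology is not reduced.
\<close>

definition chain_bd :: "('a list \<Rightarrow> 'k::field) \<Rightarrow> 'a list \<Rightarrow> 'k" where
  "chain_bd c ys = (if ys = [] then 0 else \<Sum>x | c (x # ys) \<noteq> 0. c (x # ys))"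

definition cycles :: "nat \<Rightarrow> 'a set set \<Rightarrow> ('a list \<Rightarrow> 'k::field) set" where
  "cycles n K = {c \<in> oriented_chains n K. chain_bd c = (\<lambda>_. 0)}"

definition boundaries :: "nat \<Rightarrow> 'a set set \<Rightarrow> ('a list \<Rightarrow> 'k::field) set" where
  "boundaries n K = chain_bd ` oriented_chains (Suc n) K"

definition homology_space :: "nat \<Rightarrow> 'a set set \<Rightarrow> ('k::field, ('a list \<Rightarrow> 'k) set) module" where
  "homology_space n K =
     quotient_space ((chain_space n K)\<lparr>carrier := cycles n K\<rparr>) (boundaries n K)"

text \<open>The total homology, as a single (ungraded) vector space.\<close>

definition total_homology ::
    "'a set set \<Rightarrow> ('k::field, nat \<Rightarrow> ('a list \<Rightarrow> 'k) set) module" where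
  "total_homology K = direct_sum_space (\<lambda>n. homology_space n K)"

text \<open>
  The map on homology induced by an inclusion of a subcomplex into \<^term>\<open>L\<close>. On chains extended
  by 0 to all lists, the inclusion is the identity, so the class of a cycle \<open>c\<close> is sent to the
  coset of \<open>c\<close> modulo the boundaries of \<^term>\<open>L\<close>.
\<close>

definition homology_incl ::
    "'a set set \<Rightarrow> (nat \<Rightarrow> ('a list \<Rightarrow> 'k::field) set) \<Rightarrow> nat \<Rightarrow> ('a list \<Rightarrow> 'k) set" where
  "homology_incl L h = (\<lambda>n. \<Union>c\<in>h n. boundaries n L +>\<^bsub>chain_space n L\<^esub> c)"

definition VR :: "'a set \<Rightarrow> ('a \<Rightarrow> 'a \<Rightarrow> real) \<Rightarrow> real \<Rightarrow> 'a set set" where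
  "VR X d r = {\<sigma>. \<sigma> \<noteq> {} \<and> \<sigma> \<subseteq> X \<and> (\<forall>x\<in>\<sigma>. \<forall>x'\<in>\<sigma>. d x x' \<le> 2 * r)}"


section \<open>The category PVec\<close>

record ('i, 'k, 'v) pvec =
  idx :: "'i set"
  fibre :: "'i \<Rightarrow> ('k, 'v) module"

record ('i, 'j, 'v, 'w) pvec_map =
  on_idx :: "'i \<Rightarrow> 'j"
  on_fibre :: "'i \<Rightarrow> 'v \<Rightarrow> 'w"

definition pvec_hom ::
    "('i, 'k::field, 'v) pvec \<Rightarrow> ('j, 'k, 'w) pvec \<Rightarrow> ('i, 'j, 'v, 'w) pvec_map set" where
  "pvec_hom P Q =
     {m. \<forall>i\<in>idx P. on_idx m i \<in> idx Q \<and>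
           linear_map class_ring (fibre P i) (fibre Q (on_idx m i)) (on_fibre m i)}"

definition pvec_comp ::
    "('j, 'l, 'w, 'u) pvec_map \<Rightarrow> ('i, 'j, 'v, 'w) pvec_map \<Rightarrow> ('i, 'l, 'v, 'u) pvec_map"
    (infixl \<open>\<circ>\<^sub>P\<close> 55) where
  "n \<circ>\<^sub>P m = \<lparr>on_idx = on_idx n \<circ> on_idx m,
             on_fibre = (\<lambda>i. on_fibre n (on_idx m i) \<circ> on_fibre m i)\<rparr>"

text \<open>
  HOL functions are total, so equality of two morphisms with source \<^term>\<open>P\<close> has to be
  restricted to the indices and vectors of \<^term>\<open>P\<close>.
\<close>

definition pvec_eq ::
    "('i, 'k, 'v) pvec \<Rightarrow> ('i, 'j, 'v, 'w) pvec_map \<Rightarrow> ('i, 'j, 'v, 'w) pvec_map \<Rightarrow> bool" where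
  "pvec_eq P m m' \<longleftrightarrow>
     (\<forall>i\<in>idx P. on_idx m i = on_idx m' i \<and>
        (\<forall>v\<in>carrier (fibre P i). on_fibre m i v = on_fibre m' i v))"


section \<open>Functors from the product order on pairs of reals to Fun(O(R), PVec)\<close>

text \<open>
  The data of a functor O(R) -> PVec; \<^term>\<open>omor F U V\<close> is the value at the inclusion of
  \<^term>\<open>U\<close> into \<^term>\<open>V\<close> and is only relevant for open \<^term>\<open>U \<subseteq> V\<close>.
\<close>

record ('i, 'k, 'v) opens_functor =
  oob :: "real set \<Rightarrow> ('i, 'k, 'v) pvec"
  omor :: "real set \<Rightarrow> real set \<Rightarrow> ('i, 'i, 'v, 'v) pvec_map"

text \<open>
  The data of a functor from pairs of reals to Fun(O(R), PVec); for \<^term>\<open>p \<le> q\<close>,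
  \<^term>\<open>pmor F p q\<close> is the family of components of a natural transformation.
\<close>

record ('i, 'k, 'v) pers_functor =
  pob :: "real \<times> real \<Rightarrow> ('i, 'k, 'v) opens_functor"
  pmor :: "real \<times> real \<Rightarrow> real \<times> real \<Rightarrow> real set \<Rightarrow> ('i, 'i, 'v, 'v) pvec_map"

definition opens_nat_trans ::
    "('i, 'k::field, 'v) opens_functor \<Rightarrow> ('j, 'k, 'w) opens_functor \<Rightarrow>
     (real set \<Rightarrow> ('i, 'j, 'v, 'w) pvec_map) \<Rightarrow> bool" where
  "opens_nat_trans F G \<eta> \<longleftrightarrow>
     (\<forall>U. open U \<longrightarrow> \<eta> U \<in> pvec_hom (oob F U) (oob G U)) \<and>
     (\<forall>U V. open U \<and> open V \<and> U \<subseteq> V \<longrightarrow>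
        pvec_eq (oob F U) (omor G U V \<circ>\<^sub>P \<eta> U) (\<eta> V \<circ>\<^sub>P omor F U V))"

definition pers_nat_trans ::
    "('i, 'k::field, 'v) pers_functor \<Rightarrow> ('j, 'k, 'w) pers_functor \<Rightarrow>
     (real \<times> real \<Rightarrow> real set \<Rightarrow> ('i, 'j, 'v, 'w) pvec_map) \<Rightarrow> bool" where
  "pers_nat_trans F G \<phi> \<longleftrightarrow>
     (\<forall>p. opens_nat_trans (pob F p) (pob G p) (\<phi> p)) \<and>
     (\<forall>p q U. p \<le> q \<and> open U \<longrightarrow>
        pvec_eq (oob (pob F p) U) (pmor G p q U \<circ>\<^sub>P \<phi> p U) (\<phi> q U \<circ>\<^sub>P pmor F p q U))"


section \<open>Smoothing and the interleaving distance\<close>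

definition thicken :: "real \<Rightarrow> real set \<Rightarrow> real set" where
  "thicken \<epsilon> U = (if \<epsilon> = 0 then U else {t. \<exists>v\<in>U. \<bar>t - v\<bar> < \<epsilon>})"

definition smoothing :: "real \<Rightarrow> ('i, 'k, 'v) pers_functor \<Rightarrow> ('i, 'k, 'v) pers_functor" where
  "smoothing \<epsilon> F =
     \<lparr>pob = (\<lambda>p. \<lparr>oob = (\<lambda>U. oob (pob F (p + (\<epsilon>, \<epsilon>))) (thicken \<epsilon> U)),
                 omor = (\<lambda>U V. omor (pob F (p + (\<epsilon>, \<epsilon>))) (thicken \<epsilon> U) (thicken \<epsilon> V))\<rparr>),
      pmor = (\<lambda>p q U. pmor F (p + (\<epsilon>, \<epsilon>)) (q + (\<epsilon>, \<epsilon>)) (thicken \<epsilon> U))\<rparr>"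

definition smoothing_trans ::
    "real \<Rightarrow> (real \<times> real \<Rightarrow> real set \<Rightarrow> ('i, 'j, 'v, 'w) pvec_map) \<Rightarrow>
     real \<times> real \<Rightarrow> real set \<Rightarrow> ('i, 'j, 'v, 'w) pvec_map" where
  "smoothing_trans \<epsilon> \<phi> = (\<lambda>p U. \<phi> (p + (\<epsilon>, \<epsilon>)) (thicken \<epsilon> U))"

definition smoothing_unit ::
    "real \<Rightarrow> ('i, 'k, 'v) pers_functor \<Rightarrow>
     real \<times> real \<Rightarrow> real set \<Rightarrow> ('i, 'i, 'v, 'v) pvec_map" where
  "smoothing_unit \<epsilon> F =
     (\<lambda>p U. pmor F p (p + (\<epsilon>, \<epsilon>)) (thicken \<epsilon> U) \<circ>\<^sub>P omor (pob F p) U (thicken \<epsilon> U))"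

definition interleaved ::
    "real \<Rightarrow> ('i, 'k::field, 'v) pers_functor \<Rightarrow> ('j, 'k, 'w) pers_functor \<Rightarrow> bool" where
  "interleaved \<epsilon> F G \<longleftrightarrow>
     (\<exists>\<phi> \<psi>. pers_nat_trans F (smoothing \<epsilon> G) \<phi> \<and> pers_nat_trans G (smoothing \<epsilon> F) \<psi> \<and>
        (\<forall>p U. open U \<longrightarrow>
           pvec_eq (oob (pob F p) U) (smoothing_trans \<epsilon> \<psi> p U \<circ>\<^sub>P \<phi> p U)
             (smoothing_unit (2 * \<epsilon>) F p U) \<and>
           pvec_eq (oob (pob G p) U) (smoothing_trans \<epsilon> \<phi> p U \<circ>\<^sub>P \<psi> p U)
             (smoothing_unit (2 * \<epsilon>) G p U)))"

text \<open>
  Distances take values in the extended nonnegative reals: the infimum of the empty set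
  is \<open>\<infinity>\<close>, and a supremum of distances over the empty set is 0.
\<close>

definition interleaving_distance ::
    "('i, 'k::field, 'v) pers_functor \<Rightarrow> ('j, 'k, 'w) pers_functor \<Rightarrow> ennreal" where
  "interleaving_distance F G = (INF \<epsilon>\<in>{\<epsilon>. 0 \<le> \<epsilon> \<and> interleaved \<epsilon> F G}. ennreal \<epsilon>)"


section \<open>The persistent discrete decorated Reeb graph\<close>

definition level_complex ::
    "'a set \<Rightarrow> ('a \<Rightarrow> 'a \<Rightarrow> real) \<Rightarrow> ('a \<Rightarrow> real) \<Rightarrow> real \<Rightarrow> real set \<Rightarrow> 'a set set" where
  "level_complex X d f r U = full_subcomplex (VR X d r) {x \<in> X. f x \<in> U}"

type_synonym ('a, 'k) reeb_functor =
  "('a set, 'k, nat \<Rightarrow> ('a list \<Rightarrow> 'k) set) pers_functor"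

definition reeb_ob ::
    "'a set \<Rightarrow> ('a \<Rightarrow> 'a \<Rightarrow> real) \<Rightarrow> ('a \<Rightarrow> real) \<Rightarrow> real \<times> real \<Rightarrow> real set \<Rightarrow>
     ('a set, 'k::field, nat \<Rightarrow> ('a list \<Rightarrow> 'k) set) pvec" where
  "reeb_ob X d f = (\<lambda>(r, s) U.
     \<lparr>idx = pi0 (level_complex X d f r U), fibre = (\<lambda>A. total_homology (VR A d s))\<rparr>)"

text \<open>The structure morphism into \<^term>\<open>reeb_ob X d f (r', s') V\<close> from any \<open>reeb_ob X d f (r, s) U\<close>
  with \<open>r \<le> r'\<close>, \<open>s \<le> s'\<close> and \<open>U \<subseteq> V\<close>; as a function, it does not depend on the source.\<close>

definition reeb_map ::
    "'a set \<Rightarrow> ('a \<Rightarrow> 'a \<Rightarrow> real) \<Rightarrow> ('a \<Rightarrow> real) \<Rightarrow> real \<times> real \<Rightarrow> real set \<Rightarrow>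
     ('a set, 'a set, nat \<Rightarrow> ('a list \<Rightarrow> 'k::field) set, nat \<Rightarrow> ('a list \<Rightarrow> 'k) set) pvec_map" where
  "reeb_map X d f = (\<lambda>(r', s') V.
     \<lparr>on_idx = (\<lambda>A. component_containing (level_complex X d f r' V) A),
      on_fibre = (\<lambda>A. homology_incl (VR (component_containing (level_complex X d f r' V) A) d s'))\<rparr>)"

definition decorated_reeb ::
    "'a set \<Rightarrow> ('a \<Rightarrow> 'a \<Rightarrow> real) \<Rightarrow> ('a \<Rightarrow> real) \<Rightarrow> ('a, 'k::field) reeb_functor" where
  "decorated_reeb X d f =
     \<lparr>pob = (\<lambda>p. \<lparr>oob = reeb_ob X d f p, omor = (\<lambda>U V. reeb_map X d f p V)\<rparr>),
      pmor = (\<lambda>p q U. reeb_map X d f q U)\<rparr>"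


section \<open>The functional distortion distance\<close>

definition correspondence :: "'a set \<Rightarrow> 'b set \<Rightarrow> ('a \<Rightarrow> 'b) \<Rightarrow> ('b \<Rightarrow> 'a) \<Rightarrow> ('a \<times> 'b) set" where
  "correspondence X Y \<Phi> \<Psi> = {(x, y) \<in> X \<times> Y. y = \<Phi> x \<or> x = \<Psi> y}"

definition distortion ::
    "'a set \<Rightarrow> ('a \<Rightarrow> 'a \<Rightarrow> real) \<Rightarrow> 'b set \<Rightarrow> ('b \<Rightarrow> 'b \<Rightarrow> real) \<Rightarrow>
     ('a \<Rightarrow> 'b) \<Rightarrow> ('b \<Rightarrow> 'a) \<Rightarrow> ennreal" where
  "distortion X dX Y dY \<Phi> \<Psi> =
     (SUP ((x, y), (x', y')) \<in> correspondence X Y \<Phi> \<Psi> \<times> correspondence X Y \<Phi> \<Psi>.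
        ennreal \<bar>dX x x' - dY y y'\<bar>)"

definition sup_norm_on :: "'a set \<Rightarrow> ('a \<Rightarrow> real) \<Rightarrow> ennreal" where
  "sup_norm_on X h = (SUP x\<in>X. ennreal \<bar>h x\<bar>)"

definition fun_dist ::
    "'a set \<Rightarrow> ('a \<Rightarrow> 'a \<Rightarrow> real) \<Rightarrow> ('a \<Rightarrow> real) \<Rightarrow>
     'b set \<Rightarrow> ('b \<Rightarrow> 'b \<Rightarrow> real) \<Rightarrow> ('b \<Rightarrow> real) \<Rightarrow> ('a \<Rightarrow> 'b) \<Rightarrow> ('b \<Rightarrow> 'a) \<Rightarrow> ennreal" where
  "fun_dist X dX f Y dY g \<Phi> \<Psi> =
     max (distortion X dX Y dY \<Phi> \<Psi> / 2)
       (max (sup_norm_on X (\<lambda>x. f x - g (\<Phi> x))) (sup_norm_on Y (\<lambda>y. g y - f (\<Psi> y))))"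

definition functional_distortion_distance ::
    "'a set \<Rightarrow> ('a \<Rightarrow> 'a \<Rightarrow> real) \<Rightarrow> ('a \<Rightarrow> real) \<Rightarrow>
     'b set \<Rightarrow> ('b \<Rightarrow> 'b \<Rightarrow> real) \<Rightarrow> ('b \<Rightarrow> real) \<Rightarrow> ennreal" where
  "functional_distortion_distance X dX f Y dY g =
     (INF (\<Phi>, \<Psi>) \<in> (X \<rightarrow> Y) \<times> (Y \<rightarrow> X). fun_dist X dX f Y dY g \<Phi> \<Psi>)"

end

theory Submission
  imports Defs
begin

text \<open>
If \<open>FunDist(\<Phi>, \<Psi>) < \<epsilon>\<close>, then \<open>\<Phi>\<close> and \<open>\<Psi>\<close> induce an \<open>\<epsilon>\<close>-interleaving of the two decorated Reeb
graphs, and the inequality follows by letting \<open>\<epsilon>\<close> decrease to \<open>FunDist(\<Phi>, \<Psi>)\<close>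
and taking the infimum over all pairs of maps. The strict inequality matters because thickening
is by open intervals.

The map \<open>\<Phi>\<close> changes distances by less than \<open>2\<epsilon>\<close> and function values by less than \<open>\<epsilon>\<close>. As a
simplex of \<open>VR(X, r)\<close> has diameter at most \<open>2r\<close>, \<open>\<Phi>\<close> maps \<open>VR(X, r)\<close> into \<open>VR(Y, r + \<epsilon>)\<close> and
the level complex over \<open>U\<close> into the one over \<open>U\<^sup>\<epsilon>\<close>. Hence it maps components to components and
induces linear maps on the homology of the decorations. Both structure morphisms and the maps of
the interleaving have the form ``induced by a vertex map'' (\<open>reeb_morphism\<close>), and composing
morphisms of this form composes the vertex maps (\<open>reeb_morphism_comp\<close>); naturality is a special
case of this.

It remains to compare \<open>\<Psi> \<circ> \<Phi>\<close> with the inclusion at parameters shifted by \<open>2\<epsilon>\<close>. Both \<open>(x, \<Phi> x)\<close>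
and \<open>(\<Psi> (\<Phi> x'), \<Phi> x')\<close> lie in the correspondence, so that
\<open>d(x, \<Psi> (\<Phi> x')) < d(\<Phi> x, \<Phi> x') + 2\<epsilon> < d(x, x') + 4\<epsilon>\<close>. For every simplex \<open>\<sigma>\<close> the union of \<open>\<sigma>\<close> and
its image is therefore a simplex at the larger scale: the two maps are contiguous. In particular
\<open>x\<close> and \<open>\<Psi> (\<Phi> x)\<close> are joined by an edge, so that both maps have the same effect on components, and
contiguous maps agree on homology (\<open>pushforward_contiguous_homologous\<close>).

The last fact needs an argument that is valid over every field and for alternating chains, where
the usual prism operator is unavailable without a choice of an ordering of the vertices.
Instead the values of the map are changed at one vertex \<open>v\<close> at a time. If \<open>h\<close> and \<open>h'\<close> differ only
at \<open>v\<close>, with \<open>h v = a\<close> and \<open>h' v = b\<close>, and \<open>w\<close> is the image of the link of \<open>v\<close> in a cycle \<open>c\<close>, then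
\<open>h'\<^sub># c - h\<^sub># c = b * w - a * w\<close>, and this is the boundary of \<open>a * b * w\<close> since \<open>w\<close> is a cycle
for the augmented boundary. Here \<open>*\<close> is the join with a vertex.
\<close>

section \<open>Alternating functions on lists\<close>

text \<open>
The second condition does not follow from the first one in characteristic 2. Stating the
conditions for adjacent positions only makes them accessible to structural induction on the list.
\<close>

definition alternating :: "('a list \<Rightarrow> 'k::field) \<Rightarrow> bool" where
  "alternating c \<longleftrightarrow>
     (\<forall>us x y vs. c (us @ x # y # vs) = - c (us @ y # x # vs)) \<and>
     (\<forall>us x vs. c (us @ x # x # vs) = 0)"

text \<open>
This form suits inductions on the list that pass from \<open>c\<close> to \<open>\<lambda>zs. c (x # zs)\<close>.
\<close>

lemma alternating_Cons_iff:
  "alternating c \<longleftrightarrow>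
     (\<forall>x. alternating (\<lambda>zs. c (x # zs))) \<and>
     (\<forall>x y zs. c (x # y # zs) = - c (y # x # zs)) \<and> (\<forall>x zs. c (x # x # zs) = 0)"
    (is "?A \<longleftrightarrow> ?B")
proof
  assume c: ?A
  have "c (us @ x # y # vs) = - c (us @ y # x # vs)" "c (us @ x # x # vs) = 0" for us x y vs
    using c unfolding alternating_def by blast+
  note head = this[of "[]", unfolded append_Nil] and tail = this[of "u # us" for u us, unfolded append_Cons]
  show ?B
    unfolding alternating_def by (intro conjI allI; (rule head tail))
next
  assume c: ?B
  then have head: "c (x # y # zs) = - c (y # x # zs)" "c (x # x # zs) = 0" for x y zs
    by blast+
  have tail: "c (u # us @ x # y # vs) = - c (u # us @ y # x # vs)" "c (u # us @ x # x # vs) = 0"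
    for u us x y vs
    using c unfolding alternating_def by blast+
  have "c (us @ x # y # vs) = - c (us @ y # x # vs)" for us x y vs
    by (cases us) (simp_all only: append_Nil append_Cons, rule head, rule tail)
  moreover have "c (us @ x # x # vs) = 0" for us x vs
    by (cases us) (simp_all only: append_Nil append_Cons head(2) tail(2))
  ultimately show ?A unfolding alternating_def by blast
qed

lemma alternating_Cons: "alternating c \<Longrightarrow> alternating (\<lambda>zs. c (x # zs))"
  by (subst (asm) alternating_Cons_iff) blast

lemma alternating_adjacent:
  assumes "alternating c"
  shows "c (us @ x # y # vs) = - c (us @ y # x # vs)" and "c (us @ x # x # vs) = 0"
  using assms unfolding alternating_def by blast+

text \<open>
A transposition is a conjugate of a transposition of closer positions by an adjacent
transposition.
\<close>

lemma alternating_swap: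
  assumes c: "alternating c"
  shows "c (us @ x # ms @ y # vs) = - c (us @ y # ms @ x # vs)"
proof (induction ms arbitrary: us)
  case Nil
  show ?case unfolding append_Nil by (rule alternating_adjacent(1)[OF c])
next
  case (Cons m ms)
  have "c (us @ x # (m # ms) @ y # vs) = - c (us @ m # x # ms @ y # vs)"
    using alternating_adjacent(1)[OF c, of us x m "ms @ y # vs"] by simp
  also have "\<dots> = c (us @ m # y # ms @ x # vs)"
    using Cons[of "us @ [m]"] by simp
  also have "\<dots> = - c (us @ y # (m # ms) @ x # vs)"
    using alternating_adjacent(1)[OF c, of us m y "ms @ x # vs"] by simp
  finally show ?case .
qed

lemma alternating_repeated:
  assumes c: "alternating c"
  shows "c (us @ x # ms @ x # vs) = 0"
proof (induction ms arbitrary: us)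
  case Nil
  then show ?case using alternating_adjacent(2)[OF c] by simp
next
  case (Cons m ms)
  have "c (us @ x # (m # ms) @ x # vs) = - c (us @ m # x # ms @ x # vs)"
    using alternating_adjacent(1)[OF c, of us x m "ms @ x # vs"] by simp
  also have "\<dots> = 0" using Cons[of "us @ [m]"] by simp
  finally show ?case .
qed

lemma alternating_not_distinct:
  assumes "alternating c" "\<not> distinct xs"
  shows "c xs = 0"
  using not_distinct_decomp[OF assms(2)] alternating_repeated[OF assms(1)] by force

text \<open>
Distinctness of the entries and the sign rule for arbitrary transpositions are both absorbed into
\<^const>\<open>alternating\<close>.
\<close>

lemma oriented_chains_iff:
  "c \<in> oriented_chains n K \<longleftrightarrow>
     alternating c \<and> finite {xs. c xs \<noteq> 0} \<and>
     (\<forall>xs. c xs \<noteq> 0 \<longrightarrow> length xs = Suc n \<and> set xs \<in> K)"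
proof
  assume c: "c \<in> oriented_chains n K"
  have "c (us @ x # y # vs) = - c (us @ y # x # vs)" for us x y vs
  proof -
    have *: "i < j \<and> j < length xs \<longrightarrow> c (xs[i := xs ! j, j := xs ! i]) = - c xs" for xs i j
      using c unfolding oriented_chains_def by blast
    have "c (us @ y # x # vs) = - c (us @ x # y # vs)"
      using *[of "length us" "Suc (length us)" "us @ x # y # vs"]
      by (simp add: nth_append list_update_append)
    then show ?thesis by simp
  qed
  moreover have "c (us @ x # x # vs) = 0" for us x vs
  proof -
    have "c xs \<noteq> 0 \<longrightarrow> distinct xs" for xs
      using c unfolding oriented_chains_def by blast
    from this[of "us @ x # x # vs"] show ?thesis by auto
  qed
  ultimately have "alternating c" unfolding alternating_def by blast
  then show "alternating c \<and> finite {xs. c xs \<noteq> 0} \<and>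
     (\<forall>xs. c xs \<noteq> 0 \<longrightarrow> length xs = Suc n \<and> set xs \<in> K)"
    using c unfolding oriented_chains_def by blast
next
  assume c: "alternating c \<and> finite {xs. c xs \<noteq> 0} \<and>
     (\<forall>xs. c xs \<noteq> 0 \<longrightarrow> length xs = Suc n \<and> set xs \<in> K)"
  have "c (xs[i := xs ! j, j := xs ! i]) = - c xs" if "i < j" "j < length xs" for xs i j
  proof -
    define us ms vs where "us = take i xs" and "ms = take (j - Suc i) (drop (Suc i) xs)"
      and "vs = drop (Suc j) xs"
    have "xs = us @ xs ! i # drop (Suc i) xs"
      using that id_take_nth_drop[of i xs] by (simp add: us_def)
    also have "drop (Suc i) xs = ms @ xs ! j # vs"
      using that id_take_nth_drop[of "j - Suc i" "drop (Suc i) xs"]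
      by (simp add: ms_def vs_def)
    finally have xs: "xs = us @ xs ! i # ms @ xs ! j # vs" .
    have len: "length us = i" "length ms = j - Suc i"
      using that by (auto simp: us_def ms_def)
    have j: "j = length (us @ y # ms)" for y using that len by simp
    have "(us @ x # ms @ y # vs)[i := y, j := x] = us @ y # ms @ x # vs" for x y
      using list_update_length[of "us @ y # ms" y vs x] unfolding j[of y] len(1)[symmetric]
      by simp
    then have "xs[i := xs ! j, j := xs ! i] = us @ xs ! j # ms @ xs ! i # vs"
      using xs by metis
    then show ?thesis
      using alternating_swap[of c us "xs ! j" ms "xs ! i" vs] c xs by metis
  qed
  then show "c \<in> oriented_chains n K"
    using c alternating_not_distinct unfolding oriented_chains_def by blast
qed

section \<open>Pushforward of chains and joins with a vertex\<close>

text \<open>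
The induced map on chains: the value at \<open>ys\<close> is the sum of \<open>c xs\<close> over all lists \<open>xs\<close> over \<open>V\<close> with
\<open>map h xs = ys\<close>. No case distinction is needed for simplices that \<open>h\<close> collapses: if \<open>c\<close> is
alternating, then the sum vanishes at lists with repeated entries. The recursion over \<open>ys\<close> turns
all identities into inductions in which \<open>c\<close> is replaced by \<open>\<lambda>zs. c (x # zs)\<close>.
\<close>

fun pushforward :: "'a set \<Rightarrow> ('a \<Rightarrow> 'b) \<Rightarrow> ('a list \<Rightarrow> 'k::field) \<Rightarrow> 'b list \<Rightarrow> 'k" where
  "pushforward V h c [] = c []"
| "pushforward V h c (y # ys) = (\<Sum>x\<in>{x \<in> V. h x = y}. pushforward V h (\<lambda>zs. c (x # zs)) ys)"

text \<open>
The join of a chain with the vertex \<open>a\<close>, in which \<open>a * [x\<^sub>0, \<dots>, x\<^sub>n] = [a, x\<^sub>0, \<dots>, x\<^sub>n]\<close>: its value at a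
list is the alternating sum of the values of \<open>c\<close> at the lists obtained by deleting one occurrence
of \<open>a\<close>.
\<close>

fun vertex_cone :: "'a \<Rightarrow> ('a list \<Rightarrow> 'k::field) \<Rightarrow> 'a list \<Rightarrow> 'k" where
  "vertex_cone a c [] = 0"
| "vertex_cone a c (y # ys) = (if y = a then c ys else 0) - vertex_cone a (\<lambda>zs. c (y # zs)) ys"

text \<open>
The boundary that also sends a vertex to the empty simplex, so that the formula
\<open>\<partial> (a * c) = c - a * \<partial> c\<close> holds in all degrees.
\<close>

definition augmented_bd :: "'a set \<Rightarrow> ('a list \<Rightarrow> 'k::field) \<Rightarrow> 'a list \<Rightarrow> 'k" where
  "augmented_bd V c ys = (\<Sum>x\<in>V. c (x # ys))"

lemma pushforward_add: "pushforward V h (\<lambda>zs. c zs + d zs) ys = pushforward V h c ys + pushforward V h d ys"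
  by (induction ys arbitrary: c d) (simp_all add: sum.distrib)

lemma pushforward_smult: "pushforward V h (\<lambda>zs. a * c zs) ys = a * pushforward V h c ys"
  by (induction ys arbitrary: c) (simp_all add: sum_distrib_left)

lemma pushforward_zero: "pushforward V h (\<lambda>_. 0) ys = 0"
  using pushforward_smult[of V h 0 "\<lambda>_. 0" ys] by simp

lemma pushforward_uminus: "pushforward V h (\<lambda>zs. - c zs) ys = - pushforward V h c ys"
  using pushforward_smult[of V h "-1" c ys] by simp

lemma pushforward_diff: "pushforward V h (\<lambda>zs. c zs - d zs) ys = pushforward V h c ys - pushforward V h d ys"
  using pushforward_add[of V h c "\<lambda>zs. - d zs" ys] pushforward_uminus[of V h d ys] by simp

lemma pushforward_sum: "pushforward V h (\<lambda>zs. \<Sum>i\<in>I. c i zs) ys = (\<Sum>i\<in>I. pushforward V h (c i) ys)"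
  by (induction I rule: infinite_finite_induct) (simp_all add: pushforward_zero pushforward_add)

lemma vertex_cone_add: "vertex_cone a (\<lambda>zs. c zs + d zs) ys = vertex_cone a c ys + vertex_cone a d ys"
  by (induction ys arbitrary: c d) simp_all

lemma vertex_cone_smult: "vertex_cone a (\<lambda>zs. b * c zs) ys = b * vertex_cone a c ys"
  by (induction ys arbitrary: c) (simp_all add: right_diff_distrib)

lemma vertex_cone_zero: "vertex_cone a (\<lambda>_. 0) ys = 0"
  using vertex_cone_smult[of a 0 "\<lambda>_. 0" ys] by simp

lemma vertex_cone_uminus: "vertex_cone a (\<lambda>zs. - c zs) ys = - vertex_cone a c ys"
  using vertex_cone_smult[of a "-1" c ys] by simp

lemma vertex_cone_sum: "vertex_cone a (\<lambda>zs. \<Sum>i\<in>I. c i zs) ys = (\<Sum>i\<in>I. vertex_cone a (c i) ys)"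
  by (induction I rule: infinite_finite_induct) (simp_all add: vertex_cone_zero vertex_cone_add)

lemma pushforward_nonzero:
  "pushforward V h c ys \<noteq> 0 \<Longrightarrow> \<exists>xs. set xs \<subseteq> V \<and> map h xs = ys \<and> c xs \<noteq> 0"
proof (induction ys arbitrary: c)
  case Nil
  then show ?case by simp
next
  case (Cons y ys)
  then obtain x where x: "x \<in> V" "h x = y" and "pushforward V h (\<lambda>zs. c (x # zs)) ys \<noteq> 0"
    by (auto elim: sum.not_neutral_contains_not_neutral)
  with Cons.IH obtain xs where "set xs \<subseteq> V" "map h xs = ys" "c (x # xs) \<noteq> 0" by blast
  with x show ?case by (intro exI[of _ "x # xs"]) simp
qed

lemma vertex_cone_nonzero:
  "vertex_cone a c ys \<noteq> 0 \<Longrightarrow> \<exists>us vs. ys = us @ a # vs \<and> c (us @ vs) \<noteq> 0"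
proof (induction ys arbitrary: c)
  case Nil
  then show ?case by simp
next
  case (Cons y ys)
  show ?case
  proof (cases "y = a \<and> c ys \<noteq> 0")
    case True
    then show ?thesis by (intro exI[of _ "[]"] exI[of _ ys]) simp
  next
    case False
    with Cons.prems have "vertex_cone a (\<lambda>zs. c (y # zs)) ys \<noteq> 0" by (auto split: if_splits)
    with Cons.IH obtain us vs where "ys = us @ a # vs" "c (y # us @ vs) \<noteq> 0" by blast
    then show ?thesis by (intro exI[of _ "y # us"] exI[of _ vs]) simp
  qed
qed

text \<open>
The terms cancel in pairs, which, unlike \<open>s = - s\<close>, suffices in characteristic 2 as well.
\<close>

lemma sum_alternating_square:
  fixes p :: "'a \<Rightarrow> 'a \<Rightarrow> 'k::field"
  assumes "\<And>x y. p x y = - p y x" "\<And>x. p x x = 0"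
  shows "(\<Sum>x\<in>F. \<Sum>y\<in>F. p x y) = 0"
proof (induction F rule: infinite_finite_induct)
  case (insert a F)
  have "(\<Sum>y\<in>F. p a y) + (\<Sum>x\<in>F. p x a) = 0"
    by (subst assms(1)) (simp add: sum_negf)
  with insert show ?case by (simp add: sum.distrib assms(2) add.commute)
qed simp_all

lemma alternating_pushforward:
  fixes c :: "'a list \<Rightarrow> 'k::field"
  assumes "alternating c"
  shows "alternating (pushforward V h c)"
proof -
  have swap: "pushforward V h c (y # y' # ys) = - pushforward V h c (y' # y # ys)"
    and rep: "pushforward V h c (y # y # ys) = 0"
    if "alternating c" for c :: "'a list \<Rightarrow> 'k" and y y' ys
  proof -
    define p where "p x x' = pushforward V h (\<lambda>zs. c (x # x' # zs)) ys" for x x'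
    have c: "c (x # x' # zs) = - c (x' # x # zs)" "c (x # x # zs) = 0" for x x' zs
      using that by (subst (asm) alternating_Cons_iff; blast)+
    have p: "p x x' = - p x' x" "p x x = 0" for x x'
      unfolding p_def c(2) pushforward_zero
      by (subst c(1)) (simp_all only: pushforward_uminus)
    show "pushforward V h c (y # y' # ys) = - pushforward V h c (y' # y # ys)"
      unfolding pushforward.simps p_def[symmetric]
      by (subst sum.swap, subst p(1)) (simp only: sum_negf)
    show "pushforward V h c (y # y # ys) = 0"
      unfolding pushforward.simps p_def[symmetric] by (rule sum_alternating_square; rule p)
  qed
  have "pushforward V h c (us @ x # y # vs) = - pushforward V h c (us @ y # x # vs) \<and>
      pushforward V h c (us @ x # x # vs) = 0"
    if "alternating c" for c :: "'a list \<Rightarrow> 'k" and us x y vs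
    using that
  proof (induction us arbitrary: c)
    case Nil
    show ?case unfolding append_Nil using swap[OF Nil] rep[OF Nil] by blast
  next
    case (Cons u us)
    have "pushforward V h (\<lambda>zs. c (w # zs)) (us @ x # y # vs)
        = - pushforward V h (\<lambda>zs. c (w # zs)) (us @ y # x # vs)"
      "pushforward V h (\<lambda>zs. c (w # zs)) (us @ x # x # vs) = 0" for w
      using Cons.IH[OF alternating_Cons[OF Cons.prems]] by blast+
    then show ?case by (simp add: sum_negf)
  qed
  then show ?thesis
    using assms unfolding alternating_def[of "pushforward V h c"] by blast
qed

lemma alternating_vertex_cone:
  fixes c :: "'a list \<Rightarrow> 'k::field"
  assumes "alternating c"
  shows "alternating (vertex_cone a c)"
proof -
  have "vertex_cone a c (us @ x # y # vs) = - vertex_cone a c (us @ y # x # vs) \<and>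
      vertex_cone a c (us @ x # x # vs) = 0"
    if "alternating c" for c :: "'a list \<Rightarrow> 'k" and us x y vs
    using that
  proof (induction us arbitrary: c)
    case Nil
    then have c: "c (x # y # zs) = - c (y # x # zs)" "c (x # x # zs) = 0" for x y zs
      by (subst (asm) alternating_Cons_iff; blast)+
    have "vertex_cone a (\<lambda>zs. c (x # y # zs)) vs = - vertex_cone a (\<lambda>zs. c (y # x # zs)) vs"
      by (subst c(1)) (simp only: vertex_cone_uminus)
    then show ?case by (simp add: c(2) vertex_cone_zero)
  next
    case (Cons u us)
    note IH = Cons.IH[OF alternating_Cons[OF Cons.prems, of u]]
    have "c (us @ x # y # vs) = - c (us @ y # x # vs)" "c (us @ x # x # vs) = 0"
      by (rule alternating_adjacent[OF Cons.prems])+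
    with IH show ?case by simp
  qed
  then show ?thesis
    using assms unfolding alternating_def[of "vertex_cone a c"] by blast
qed

lemma pushforward_cong:
  assumes "finite V" and "\<And>xs x. c xs \<noteq> 0 \<Longrightarrow> x \<in> set xs \<Longrightarrow> h x = h' x"
  shows "pushforward V h c ys = pushforward V h' c ys"
  using assms(2)
proof (induction ys arbitrary: c)
  case (Cons y ys)
  have "pushforward V h (\<lambda>zs. c (x # zs)) ys = pushforward V h' (\<lambda>zs. c (x # zs)) ys" for x
    using Cons.prems by (intro Cons.IH) auto
  moreover have "pushforward V h' (\<lambda>zs. c (x # zs)) ys = 0" if "h x \<noteq> h' x" for x
  proof -
    have "c (x # zs) = 0" for zs using Cons.prems that by (metis list.set_intros(1))
    then show ?thesis by (simp add: pushforward_zero)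
  qed
  ultimately have "(if h x = y then pushforward V h (\<lambda>zs. c (x # zs)) ys else 0)
      = (if h' x = y then pushforward V h' (\<lambda>zs. c (x # zs)) ys else 0)" for x
    by auto
  then show ?case using assms(1) by (simp only: pushforward.simps sum.inter_filter)
qed simp

lemma pushforward_id:
  assumes "finite V" and "\<And>xs. c xs \<noteq> 0 \<Longrightarrow> set xs \<subseteq> V"
  shows "pushforward V (\<lambda>x. x) c ys = c ys"
  using assms(2)
proof (induction ys arbitrary: c)
  case (Cons y ys)
  have "{x \<in> V. x = y} = (if y \<in> V then {y} else {})" by auto
  moreover have "pushforward V (\<lambda>x. x) (\<lambda>zs. c (y # zs)) ys = c (y # ys)"
  proof (rule Cons.IH)
    show "set xs \<subseteq> V" if "c (y # xs) \<noteq> 0" for xs using Cons.prems[OF that] by simp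
  qed
  moreover have "c (y # ys) = 0" if "y \<notin> V" using Cons.prems that by fastforce
  ultimately show ?case by simp
qed simp

lemma pushforward_pushforward:
  assumes "finite V" "finite W" "h ` V \<subseteq> W"
  shows "pushforward W k (pushforward V h c) ys = pushforward V (k \<circ> h) c ys"
proof (induction ys arbitrary: c)
  case (Cons z zs)
  let ?F = "{x \<in> V. k (h x) = z}" and ?G = "{y \<in> W. k y = z}"
  let ?p = "\<lambda>x. pushforward V (k \<circ> h) (\<lambda>xs. c (x # xs)) zs"
  have "pushforward W k (pushforward V h c) (z # zs) = (\<Sum>y\<in>?G. \<Sum>x\<in>{x \<in> V. h x = y}. ?p x)"
    by (simp only: pushforward.simps pushforward_sum Cons)
  also have "\<dots> = (\<Sum>y\<in>?G. \<Sum>x\<in>{x \<in> ?F. h x = y}. ?p x)"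
    by (intro sum.cong refl) auto
  also have "\<dots> = (\<Sum>x\<in>?F. ?p x)"
    using assms by (intro sum.group) auto
  also have "?F = {x \<in> V. (k \<circ> h) x = z}" by simp
  finally show ?case by (simp only: pushforward.simps)
qed simp

lemma augmented_bd_pushforward:
  assumes "finite V" "finite W" "h ` V \<subseteq> W"
  shows "augmented_bd W (pushforward V h c) ys = pushforward V h (augmented_bd V c) ys"
proof -
  have "augmented_bd W (pushforward V h c) ys
      = (\<Sum>y\<in>W. \<Sum>x\<in>{x \<in> V. h x = y}. pushforward V h (\<lambda>zs. c (x # zs)) ys)"
    by (simp add: augmented_bd_def)
  also have "\<dots> = (\<Sum>x\<in>V. pushforward V h (\<lambda>zs. c (x # zs)) ys)"
    using assms by (intro sum.group) auto
  also have "\<dots> = pushforward V h (augmented_bd V c) ys"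
    by (simp add: augmented_bd_def[abs_def] pushforward_sum)
  finally show ?thesis .
qed

lemma augmented_bd_vertex_cone:
  assumes "finite W" "a \<in> W"
  shows "augmented_bd W (vertex_cone a c) ys = c ys - vertex_cone a (augmented_bd W c) ys"
  using assms by (simp add: augmented_bd_def[abs_def] sum_subtractf vertex_cone_sum)

lemma pushforward_vertex_cone:
  assumes "finite V" "v \<in> V"
  shows "pushforward V h (vertex_cone v c) ys = vertex_cone (h v) (pushforward V h c) ys"
proof (induction ys arbitrary: c)
  case (Cons y ys)
  have "pushforward V h (vertex_cone v c) (y # ys)
      = (\<Sum>x\<in>{x \<in> V. h x = y}. (if x = v then pushforward V h c ys else 0)
           - vertex_cone (h v) (pushforward V h (\<lambda>zs. c (x # zs))) ys)"
    by (auto intro!: sum.cong simp: pushforward_diff Cons pushforward_zero)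
  also have "\<dots> = (if y = h v then pushforward V h c ys else 0)
      - vertex_cone (h v) (\<lambda>zs. \<Sum>x\<in>{x \<in> V. h x = y}. pushforward V h (\<lambda>zs. c (x # zs)) zs) ys"
    using assms by (auto simp: sum_subtractf vertex_cone_sum)
  finally show ?case by simp
qed simp

text \<open>
On the simplices that contain \<open>v\<close>, a chain is the join of \<open>v\<close> with its link, the chain
\<open>\<lambda>ys. c (v # ys)\<close>.
\<close>

lemma vertex_cone_link:
  assumes "alternating c" "v \<in> set zs"
  shows "vertex_cone v (\<lambda>ys. c (v # ys)) zs = c zs"
  using assms
proof (induction zs arbitrary: c)
  case (Cons z zs)
  have c: "c (v # z # ys) = - c (z # v # ys)" "c (v # v # ys) = 0" for ys
    using Cons.prems(1) by (subst (asm) alternating_Cons_iff; blast)+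
  show ?case
  proof (cases "z = v")
    case True
    then show ?thesis by (simp add: c(2) vertex_cone_zero)
  next
    case False
    then show ?thesis
      using Cons.IH[OF alternating_Cons[OF Cons.prems(1), of z]] Cons.prems(2)
      by (simp add: c(1) vertex_cone_uminus)
  qed
qed simp

text \<open>
Subtracting the join of \<open>v\<close> with its link from \<open>c\<close> leaves a chain supported away from \<open>v\<close>, on which
\<open>h\<close> and \<open>h'\<close> have the same effect. The two maps also agree on the link itself, so that the
difference comes from the images of \<open>v\<close> alone.
\<close>

lemma pushforward_change_vertex:
  assumes "alternating c" "finite V" "v \<in> V" and hh': "\<And>x. x \<noteq> v \<Longrightarrow> h' x = h x"
  defines "w \<equiv> pushforward V h (\<lambda>ys. c (v # ys))"
  shows "pushforward V h' c ys - pushforward V h c ys = vertex_cone (h' v) w ys - vertex_cone (h v) w ys"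
proof -
  define r where "r zs = c zs - vertex_cone v (\<lambda>ys. c (v # ys)) zs" for zs
  have "r xs = 0" if "v \<in> set xs" for xs
    using vertex_cone_link[OF assms(1) that] by (simp add: r_def)
  then have "pushforward V h' r ys = pushforward V h r ys"
    using hh' assms(2) by (intro pushforward_cong) metis+
  moreover have "pushforward V h' (\<lambda>ys. c (v # ys)) = w"
  proof -
    \<comment> \<open>the link of \<open>v\<close> is supported away from \<open>v\<close>\<close>
    have "c (v # xs) = 0" if "v \<in> set xs" for xs
      using alternating_not_distinct[OF assms(1), of "v # xs"] that by simp
    then show ?thesis
      unfolding w_def using hh' assms(2) by (intro ext pushforward_cong) metis+
  qed
  ultimately show ?thesis
    unfolding r_def pushforward_diff using assms(2,3) by (simp add: pushforward_vertex_cone w_def algebra_simps)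
qed

section \<open>The boundary operator\<close>

lemma support_subset_vertices:
  assumes "c \<in> oriented_chains n K" "\<And>\<sigma>. \<sigma> \<in> K \<Longrightarrow> \<sigma> \<subseteq> V" "c xs \<noteq> 0"
  shows "set xs \<subseteq> V"
  using assms unfolding oriented_chains_iff by blast

lemma chain_bd_eq_augmented_bd:
  assumes "finite V" "\<And>xs. c xs \<noteq> 0 \<Longrightarrow> set xs \<subseteq> V"
  shows "chain_bd c ys = (if ys = [] then 0 else augmented_bd V c ys)"
proof -
  have "(\<Sum>x | c (x # ys) \<noteq> 0. c (x # ys)) = (\<Sum>x\<in>V. c (x # ys))"
    using assms(1) by (intro sum.mono_neutral_left) (auto dest: assms(2))
  then show ?thesis by (simp add: chain_bd_def augmented_bd_def)
qed

lemma finite_support_bound: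
  assumes "finite {xs. c xs \<noteq> 0}"
  obtains V where "finite V" "\<And>xs. c xs \<noteq> 0 \<Longrightarrow> set xs \<subseteq> V"
  using assms by (intro that[of "\<Union> (set ` {xs. c xs \<noteq> 0})"]) auto

lemma chain_bd_add:
  assumes "finite {xs. c xs \<noteq> 0}" "finite {xs. d xs \<noteq> 0}"
  shows "chain_bd (\<lambda>xs. c xs + d xs) = (\<lambda>ys. chain_bd c ys + chain_bd d ys)"
proof
  fix ys
  obtain V W where V: "finite V" "\<And>xs. c xs \<noteq> 0 \<Longrightarrow> set xs \<subseteq> V"
    and W: "finite W" "\<And>xs. d xs \<noteq> 0 \<Longrightarrow> set xs \<subseteq> W"
    using finite_support_bound[OF assms(1)] finite_support_bound[OF assms(2)] by metis
  have U: "finite (V \<union> W)" using V W by blast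
  have c: "set xs \<subseteq> V \<union> W" if "c xs \<noteq> 0" for xs using V(2) that by blast
  have d: "set xs \<subseteq> V \<union> W" if "d xs \<noteq> 0" for xs using W(2) that by blast
  have cd: "set xs \<subseteq> V \<union> W" if "c xs + d xs \<noteq> 0" for xs
    using c[of xs] d[of xs] that by (cases "c xs = 0") auto
  have "chain_bd c ys = (if ys = [] then 0 else augmented_bd (V \<union> W) c ys)"
    by (rule chain_bd_eq_augmented_bd[OF U c])
  moreover have "chain_bd d ys = (if ys = [] then 0 else augmented_bd (V \<union> W) d ys)"
    by (rule chain_bd_eq_augmented_bd[OF U d])
  moreover have "chain_bd (\<lambda>xs. c xs + d xs) ys
      = (if ys = [] then 0 else augmented_bd (V \<union> W) (\<lambda>xs. c xs + d xs) ys)"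
    by (rule chain_bd_eq_augmented_bd[OF U cd])
  ultimately show "chain_bd (\<lambda>xs. c xs + d xs) ys = chain_bd c ys + chain_bd d ys"
    by (simp add: augmented_bd_def sum.distrib)
qed

lemma chain_bd_smult: "chain_bd (\<lambda>xs. a * c xs) = (\<lambda>ys. a * chain_bd c ys)"
  by (cases "a = 0") (auto simp: chain_bd_def sum_distrib_left)

lemma chain_bd_zero: "chain_bd (\<lambda>_. 0) = (\<lambda>_. 0)"
  by (auto simp: chain_bd_def)

section \<open>Chains, cycles and boundaries as vector spaces\<close>

text \<open>
All vector spaces in question are sets of functions with pointwise operations, modulo a smaller
such set.
\<close>

definition function_subspace :: "('i \<Rightarrow> 'k::field) set \<Rightarrow> bool" where
  "function_subspace S \<longleftrightarrow>
     (\<lambda>_. 0) \<in> S \<and> (\<forall>c\<in>S. \<forall>d\<in>S. (\<lambda>x. c x + d x) \<in> S) \<and> (\<forall>a. \<forall>c\<in>S. (\<lambda>x. a * c x) \<in> S)"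

lemma function_subspaceD:
  assumes "function_subspace S"
  shows "(\<lambda>_. 0) \<in> S" and "c \<in> S \<Longrightarrow> d \<in> S \<Longrightarrow> (\<lambda>x. c x + d x) \<in> S"
    and "c \<in> S \<Longrightarrow> (\<lambda>x. a * c x) \<in> S" and "c \<in> S \<Longrightarrow> (\<lambda>x. - c x) \<in> S"
proof -
  show *: "(\<lambda>_. 0) \<in> S" "c \<in> S \<Longrightarrow> d \<in> S \<Longrightarrow> (\<lambda>x. c x + d x) \<in> S"
    "c \<in> S \<Longrightarrow> (\<lambda>x. a * c x) \<in> S" for c d a
    using assms unfolding function_subspace_def by blast+
  show "c \<in> S \<Longrightarrow> (\<lambda>x. - c x) \<in> S" using *(3)[of c "- 1"] by simp
qed

lemma alternating_add:
  assumes "alternating c" "alternating d"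
  shows "alternating (\<lambda>xs. c xs + d xs)"
proof -
  have "c (us @ x # y # vs) + d (us @ x # y # vs) = - (c (us @ y # x # vs) + d (us @ y # x # vs))"
    for us x y vs
    by (subst (1 2) alternating_adjacent(1)) (simp_all add: assms)
  moreover have "c (us @ x # x # vs) + d (us @ x # x # vs) = 0" for us x vs
    by (simp add: alternating_adjacent(2) assms)
  ultimately show ?thesis unfolding alternating_def by blast
qed

lemma alternating_smult:
  assumes "alternating c"
  shows "alternating (\<lambda>xs. a * c xs)"
proof -
  have "a * c (us @ x # y # vs) = - (a * c (us @ y # x # vs))" for us x y vs
    by (subst alternating_adjacent(1)) (simp_all add: assms)
  moreover have "a * c (us @ x # x # vs) = 0" for us x vs
    by (simp add: alternating_adjacent(2) assms)
  ultimately show ?thesis unfolding alternating_def by blast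
qed

lemma function_subspace_oriented_chains:
  "function_subspace (oriented_chains n K :: ('a list \<Rightarrow> 'k::field) set)"
  unfolding function_subspace_def
proof (intro conjI ballI allI)
  show "(\<lambda>_. 0) \<in> (oriented_chains n K :: ('a list \<Rightarrow> 'k) set)"
    by (simp add: oriented_chains_def)
next
  fix c d :: "'a list \<Rightarrow> 'k"
  assume c: "c \<in> oriented_chains n K" and d: "d \<in> oriented_chains n K"
  have "finite {xs. c xs + d xs \<noteq> 0}"
    by (rule finite_subset[of _ "{xs. c xs \<noteq> 0} \<union> {xs. d xs \<noteq> 0}"])
      (use c d in \<open>auto simp: oriented_chains_iff\<close>)
  moreover have "length xs = Suc n \<and> set xs \<in> K" if "c xs + d xs \<noteq> 0" for xs
  proof (cases "c xs = 0")
    case True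
    then show ?thesis using d that by (simp add: oriented_chains_iff)
  next
    case False
    then show ?thesis using c by (simp add: oriented_chains_iff)
  qed
  ultimately show "(\<lambda>xs. c xs + d xs) \<in> oriented_chains n K"
    using c d alternating_add[of c d] unfolding oriented_chains_iff by blast
next
  fix a :: 'k and c :: "'a list \<Rightarrow> 'k"
  assume c: "c \<in> oriented_chains n K"
  have "finite {xs. a * c xs \<noteq> 0}"
    by (rule finite_subset[of _ "{xs. c xs \<noteq> 0}"]) (use c in \<open>auto simp: oriented_chains_iff\<close>)
  then show "(\<lambda>xs. a * c xs) \<in> oriented_chains n K"
    using c alternating_smult[of c a] unfolding oriented_chains_iff by auto
qed

lemma finite_support: "c \<in> oriented_chains n K \<Longrightarrow> finite {xs. c xs \<noteq> 0}"
  by (simp add: oriented_chains_iff)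

lemma function_subspace_cycles: "function_subspace (cycles n K)"
  using function_subspaceD[OF function_subspace_oriented_chains[of n K]]
  unfolding function_subspace_def cycles_def
  by (auto simp: chain_bd_zero chain_bd_smult chain_bd_add finite_support)

lemma function_subspace_boundaries: "function_subspace (boundaries n K)"
  unfolding function_subspace_def
proof (intro conjI ballI allI)
  note C = function_subspaceD[OF function_subspace_oriented_chains[of "Suc n" K]]
  show "(\<lambda>_. 0) \<in> boundaries n K"
    unfolding boundaries_def using C(1) by (intro image_eqI[of _ _ "\<lambda>_. 0"]) (simp_all add: chain_bd_zero)
  show "(\<lambda>x. c x + d x) \<in> boundaries n K"
    if cd: "c \<in> boundaries n K" "d \<in> boundaries n K" for c d
  proof -
    from cd obtain c' d' where "c' \<in> oriented_chains (Suc n) K" "c = chain_bd c'"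
      "d' \<in> oriented_chains (Suc n) K" "d = chain_bd d'" unfolding boundaries_def by blast
    then show ?thesis
      unfolding boundaries_def
      by (intro image_eqI[of _ _ "\<lambda>xs. c' xs + d' xs"])
        (simp_all add: chain_bd_add finite_support C(2))
  qed
  show "(\<lambda>x. a * c x) \<in> boundaries n K" if c: "c \<in> boundaries n K" for a c
  proof -
    from c obtain c' where "c' \<in> oriented_chains (Suc n) K" "c = chain_bd c'"
      unfolding boundaries_def by blast
    then show ?thesis
      unfolding boundaries_def
      by (intro image_eqI[of _ _ "\<lambda>xs. a * c' xs"]) (simp_all add: chain_bd_smult C(3))
  qed
qed

text \<open>
Closure under faces. It ensures that the boundary of a chain of \<open>K\<close> is again a chain of \<open>K\<close>.
\<close>

definition hereditary :: "'a set set \<Rightarrow> bool" where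
  "hereditary K \<longleftrightarrow> (\<forall>\<sigma>\<in>K. \<forall>\<tau>. \<tau> \<noteq> {} \<and> \<tau> \<subseteq> \<sigma> \<longrightarrow> \<tau> \<in> K)"

lemma hereditaryD:
  "hereditary K \<Longrightarrow> \<sigma> \<in> K \<Longrightarrow> \<tau> \<noteq> {} \<Longrightarrow> \<tau> \<subseteq> \<sigma> \<Longrightarrow> \<tau> \<in> K"
  unfolding hereditary_def by blast

text \<open>
The iterated boundary is a sum over pairs of vertices that is antisymmetric in the pair.
\<close>

lemma chain_bd_oriented_chain:
  fixes c :: "'a list \<Rightarrow> 'k::field"
  assumes c: "c \<in> oriented_chains (Suc n) K" and K: "hereditary K"
  shows "chain_bd c \<in> oriented_chains n K" and "chain_bd (chain_bd c) = (\<lambda>_. 0)"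
proof -
  obtain V where V: "finite V" "\<And>xs. c xs \<noteq> 0 \<Longrightarrow> set xs \<subseteq> V"
    using finite_support_bound[OF finite_support[OF c]] by blast
  have alt: "alternating c" using c by (simp add: oriented_chains_iff)
  have bd: "chain_bd c ys = (if ys = [] then 0 else \<Sum>x\<in>V. c (x # ys))" for ys
    using chain_bd_eq_augmented_bd[of V c ys, OF V] by (simp add: augmented_bd_def)
  have supp: "\<exists>x. c (x # ys) \<noteq> 0 \<and> ys \<noteq> []" if "chain_bd c ys \<noteq> 0" for ys
    using that unfolding bd by (auto split: if_splits elim: sum.not_neutral_contains_not_neutral)
  have "chain_bd c (us @ x # y # vs) = - chain_bd c (us @ y # x # vs)" for us x y vs
  proof -
    have "c (z # us @ x # y # vs) = - c (z # us @ y # x # vs)" for z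
      using alternating_adjacent(1)[OF alt, of "z # us" x y vs] by simp
    then show ?thesis by (simp add: bd sum_negf)
  qed
  moreover have "chain_bd c (us @ x # x # vs) = 0" for us x vs
    using alternating_adjacent(2)[OF alt, of "_ # us" x vs] by (simp add: bd)
  ultimately have "alternating (chain_bd c)" unfolding alternating_def by blast
  moreover have "finite {ys. chain_bd c ys \<noteq> 0}"
  proof (rule finite_subset)
    show "{ys. chain_bd c ys \<noteq> 0} \<subseteq> tl ` {xs. c xs \<noteq> 0}"
      using supp by force
    show "finite (tl ` {xs. c xs \<noteq> 0})" using finite_support[OF c] by simp
  qed
  moreover have "length ys = Suc n \<and> set ys \<in> K" if bd0: "chain_bd c ys \<noteq> 0" for ys
  proof -
    obtain x where "c (x # ys) \<noteq> 0" "ys \<noteq> []" using supp[OF bd0] by blast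
    with c have "length (x # ys) = Suc (Suc n)" "set (x # ys) \<in> K"
      unfolding oriented_chains_iff by blast+
    moreover have "set ys \<noteq> {}" "set ys \<subseteq> set (x # ys)" using \<open>ys \<noteq> []\<close> by auto
    ultimately show ?thesis using K unfolding hereditary_def by auto
  qed
  ultimately show bdc: "chain_bd c \<in> oriented_chains n K" unfolding oriented_chains_iff by blast
  have "chain_bd (chain_bd c) ys = 0" for ys
  proof -
    have "set xs \<subseteq> V" if "chain_bd c xs \<noteq> 0" for xs using supp[OF that] V(2) by force
    then have "chain_bd (chain_bd c) ys
        = (if ys = [] then 0 else \<Sum>x\<in>V. \<Sum>y\<in>V. c (y # x # ys))"
      using chain_bd_eq_augmented_bd[OF V(1), of "chain_bd c" ys] by (simp add: augmented_bd_def bd)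
    moreover have "(\<Sum>x\<in>V. \<Sum>y\<in>V. c (y # x # ys)) = 0"
      by (rule sum_alternating_square)
        (rule alternating_adjacent[OF alt, of "[]", unfolded append_Nil])+
    ultimately show ?thesis by simp
  qed
  then show "chain_bd (chain_bd c) = (\<lambda>_. 0)" by blast
qed

lemma boundaries_subset_cycles: "hereditary K \<Longrightarrow> boundaries n K \<subseteq> cycles n K"
  using chain_bd_oriented_chain unfolding boundaries_def cycles_def by blast

section \<open>Homology as a vector space\<close>

definition coset :: "('i \<Rightarrow> 'k::field) set \<Rightarrow> ('i \<Rightarrow> 'k) \<Rightarrow> ('i \<Rightarrow> 'k) set" where
  "coset W c = (\<lambda>b x. b x + c x) ` W"

text \<open>
It is through this criterion that operations on representatives are well-defined on cosets.
\<close>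

lemma coset_eq_iff:
  assumes "function_subspace W"
  shows "coset W c = coset W d \<longleftrightarrow> (\<lambda>x. c x - d x) \<in> W"
proof
  assume "coset W c = coset W d"
  moreover have "c \<in> coset W c"
    unfolding coset_def by (intro image_eqI[of _ _ "\<lambda>_. 0"]) (simp_all add: function_subspaceD[OF assms])
  ultimately obtain b where "b \<in> W" "c = (\<lambda>x. b x + d x)" unfolding coset_def by blast
  then show "(\<lambda>x. c x - d x) \<in> W" by simp
next
  have sub: "coset W c \<subseteq> coset W d" if "(\<lambda>x. c x - d x) \<in> W" for c d
  proof -
    have "(\<lambda>x. b x + c x) \<in> coset W d" if "b \<in> W" for b
      unfolding coset_def
      by (intro image_eqI[of _ _ "\<lambda>x. b x + (c x - d x)"])
        (simp_all add: function_subspaceD(2)[OF assms \<open>b \<in> W\<close>] \<open>(\<lambda>x. c x - d x) \<in> W\<close>)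
    then show ?thesis unfolding coset_def[of W c] by blast
  qed
  assume cd: "(\<lambda>x. c x - d x) \<in> W"
  from function_subspaceD(4)[OF assms cd] have "(\<lambda>x. d x - c x) \<in> W" by simp
  with sub cd show "coset W c = coset W d" by blast
qed

lemma zero_coset: "coset W (\<lambda>_. 0) = W"
  unfolding coset_def by simp

lemma homology_coset:
  "boundaries n L +>\<^bsub>chain_space m K\<^esub> c = coset (boundaries n L) c"
  unfolding a_r_coset_def r_coset_def coset_def chain_space_def by auto

lemma homology_space_carrier:
  "carrier (homology_space n K) = coset (boundaries n K) ` cycles n K"
  unfolding homology_space_def quotient_space_def A_RCOSETS_def RCOSETS_def
    r_coset_def coset_def chain_space_def by auto

lemma homology_space_zero: "\<zero>\<^bsub>homology_space n K\<^esub> = boundaries n K"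
  unfolding homology_space_def quotient_space_def by simp

lemma homology_space_add:
  "coset (boundaries n K) c \<oplus>\<^bsub>homology_space n K\<^esub> coset (boundaries n K) d
     = coset (boundaries n K) (\<lambda>x. c x + d x)"
proof -
  let ?B = "boundaries n K"
  have "coset ?B c \<oplus>\<^bsub>homology_space n K\<^esub> coset ?B d
      = {\<lambda>x. (b x + c x) + (b' x + d x) | b b'. b \<in> ?B \<and> b' \<in> ?B}"
    unfolding homology_space_def quotient_space_def chain_space_def set_add_def set_mult_def coset_def
    by auto
  also have "\<dots> = coset ?B (\<lambda>x. c x + d x)" (is "?l = ?r")
  proof (intro equalityI subsetI)
    fix z
    assume "z \<in> ?l"
    then obtain b b' where "b \<in> ?B" "b' \<in> ?B" "z = (\<lambda>x. (b x + c x) + (b' x + d x))" by blast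
    then show "z \<in> ?r"
      unfolding coset_def
      by (intro image_eqI[of _ _ "\<lambda>x. b x + b' x"])
        (simp_all add: function_subspaceD(2)[OF function_subspace_boundaries] ac_simps)
  next
    fix z
    assume "z \<in> ?r"
    then obtain b where b: "b \<in> ?B" "z = (\<lambda>x. b x + (c x + d x))" unfolding coset_def by blast
    then show "z \<in> ?l"
      unfolding mem_Collect_eq
      by (intro exI[of _ b] exI[of _ "\<lambda>_. 0"])
        (simp add: function_subspaceD(1)[OF function_subspace_boundaries] ac_simps)
  qed
  finally show ?thesis .
qed

lemma homology_space_smult:
  "a \<odot>\<^bsub>homology_space n K\<^esub> coset (boundaries n K) c = coset (boundaries n K) (\<lambda>x. a * c x)"
proof -
  let ?B = "boundaries n K"
  note B = function_subspaceD[OF function_subspace_boundaries[of n K]]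
  have "a \<odot>\<^bsub>homology_space n K\<^esub> coset ?B c
      = (\<Union>b\<in>?B. coset ?B (\<lambda>x. a * (b x + c x)))"
    unfolding homology_space_def quotient_space_def chain_space_def a_r_coset_def r_coset_def coset_def
    by auto
  also have "coset ?B (\<lambda>x. a * (b x + c x)) = coset ?B (\<lambda>x. a * c x)" if "b \<in> ?B" for b
    unfolding coset_eq_iff[OF function_subspace_boundaries]
    using B(3)[OF that] by (simp add: algebra_simps)
  then have "(\<Union>b\<in>?B. coset ?B (\<lambda>x. a * (b x + c x))) = coset ?B (\<lambda>x. a * c x)"
    using B(1) by blast
  finally show ?thesis .
qed

lemma vectorspace_homology_space:
  fixes K :: "'a set set"
  assumes "hereditary K"
  shows "vectorspace class_ring (homology_space n K :: ('k::field, ('a list \<Rightarrow> 'k) set) module)"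
proof -
  let ?H = "homology_space n K :: ('k, ('a list \<Rightarrow> 'k) set) module"
  note Z = function_subspaceD[OF function_subspace_cycles[of n K]]
  note H = homology_space_carrier homology_space_add homology_space_smult
  have zero: "\<zero>\<^bsub>?H\<^esub> = coset (boundaries n K) (\<lambda>_. 0)"
    by (simp add: homology_space_zero zero_coset)
  have "abelian_group ?H"
  proof (rule abelian_groupI)
    fix x assume "x \<in> carrier ?H"
    then obtain c where c: "c \<in> cycles n K" "x = coset (boundaries n K) c" by (auto simp: H)
    then show "\<exists>y\<in>carrier ?H. y \<oplus>\<^bsub>?H\<^esub> x = \<zero>\<^bsub>?H\<^esub>"
      by (intro bexI[of _ "coset (boundaries n K) (\<lambda>x. - c x)"]) (auto simp: H zero Z(4))
  qed (auto simp: H zero Z ac_simps)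
  then have "module class_ring ?H"
    by (intro moduleI class_cring.is_cring)
      (auto simp: H Z algebra_simps)
  then show ?thesis
    by (intro vectorspace.intro class_field)
qed

lemma vectorspace_direct_sum_space:
  fixes V :: "nat \<Rightarrow> ('k::field, 'v) module"
  assumes V: "\<And>n. vectorspace class_ring (V n)"
  shows "vectorspace class_ring (direct_sum_space V)"
proof -
  let ?D = "direct_sum_space V"
  have V': "module class_ring (V n)" for n using V by (rule vectorspace.axioms(1))
  have A: "abelian_group (V n)" for n using V' by (rule module.axioms(2))
  note mon = abelian_group.axioms(1)[OF A]
  have D: "h \<in> carrier ?D \<longleftrightarrow> (\<forall>n. h n \<in> carrier (V n)) \<and> finite {n. h n \<noteq> \<zero>\<^bsub>V n\<^esub>}" for h
    by (simp add: direct_sum_space_def)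
  have D_add: "g \<oplus>\<^bsub>?D\<^esub> h = (\<lambda>n. g n \<oplus>\<^bsub>V n\<^esub> h n)" for g h
    by (simp add: direct_sum_space_def)
  have D_zero: "\<zero>\<^bsub>?D\<^esub> = (\<lambda>n. \<zero>\<^bsub>V n\<^esub>)" by (simp add: direct_sum_space_def)
  have D_smult: "a \<odot>\<^bsub>?D\<^esub> h = (\<lambda>n. a \<odot>\<^bsub>V n\<^esub> h n)" for a h by (simp add: direct_sum_space_def)
  have add_closed: "g \<oplus>\<^bsub>?D\<^esub> h \<in> carrier ?D" if "g \<in> carrier ?D" "h \<in> carrier ?D" for g h
  proof -
    have "finite {n. g n \<oplus>\<^bsub>V n\<^esub> h n \<noteq> \<zero>\<^bsub>V n\<^esub>}"
      by (rule finite_subset[of _ "{n. g n \<noteq> \<zero>\<^bsub>V n\<^esub>} \<union> {n. h n \<noteq> \<zero>\<^bsub>V n\<^esub>}"])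
        (use that in \<open>auto simp: D abelian_monoid.l_zero[OF mon] abelian_monoid.zero_closed[OF mon]\<close>)
    then show ?thesis using that by (auto simp: D D_add abelian_monoid.a_closed[OF mon])
  qed
  have smult_closed: "a \<odot>\<^bsub>?D\<^esub> h \<in> carrier ?D" if "h \<in> carrier ?D" for a h
  proof -
    have "finite {n. a \<odot>\<^bsub>V n\<^esub> h n \<noteq> \<zero>\<^bsub>V n\<^esub>}"
      by (rule finite_subset[of _ "{n. h n \<noteq> \<zero>\<^bsub>V n\<^esub>}"])
        (use that in \<open>auto simp: D module.smult_r_null[OF V']\<close>)
    then show ?thesis using that by (auto simp: D D_smult module.smult_closed[OF V'])
  qed
  have "abelian_group ?D"
  proof (rule abelian_groupI)
    fix g assume g: "g \<in> carrier ?D"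
    have "(\<lambda>n. \<ominus>\<^bsub>V n\<^esub> g n) \<in> carrier ?D"
    proof -
      have "finite {n. \<ominus>\<^bsub>V n\<^esub> g n \<noteq> \<zero>\<^bsub>V n\<^esub>}"
        by (rule finite_subset[of _ "{n. g n \<noteq> \<zero>\<^bsub>V n\<^esub>}"])
          (use g in \<open>auto simp: D abelian_group.minus_equality[OF A] abelian_monoid.l_zero[OF mon]
              abelian_monoid.zero_closed[OF mon]\<close>)
      then show ?thesis using g by (auto simp: D abelian_group.a_inv_closed[OF A])
    qed
    then show "\<exists>h\<in>carrier ?D. h \<oplus>\<^bsub>?D\<^esub> g = \<zero>\<^bsub>?D\<^esub>"
      by (rule bexI[rotated]) (use g in \<open>simp add: D D_add D_zero abelian_group.l_neg[OF A]\<close>)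
  next
    show "\<zero>\<^bsub>?D\<^esub> \<in> carrier ?D" by (simp add: D D_zero abelian_monoid.zero_closed[OF mon])
  qed (simp_all add: add_closed, simp_all add: D D_add D_zero abelian_monoid.a_assoc[OF mon]
      abelian_monoid.a_comm[OF mon] abelian_monoid.l_zero[OF mon])
  then have "module class_ring ?D"
    by (intro moduleI class_cring.is_cring)
      (simp_all add: smult_closed, simp_all add: D D_add D_smult module.smult_l_distr[OF V', simplified]
        module.smult_r_distr[OF V', simplified] module.smult_assoc1[OF V', simplified]
        module.smult_one[OF V', simplified])
  then show ?thesis by (intro vectorspace.intro class_field)
qed

lemma vectorspace_total_homology:
  fixes K :: "'a set set"
  assumes "hereditary K"
  shows "vectorspace class_ring
    (total_homology K :: ('k::field, nat \<Rightarrow> ('a list \<Rightarrow> 'k) set) module)"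
  unfolding total_homology_def
  by (intro vectorspace_direct_sum_space vectorspace_homology_space assms)

section \<open>Chain maps\<close>

text \<open>
The condition is on chains of \<open>K\<close> only, so that the identity is a chain map for every inclusion
\<open>K \<subseteq> L\<close>.
\<close>

definition chain_map ::
    "(('a list \<Rightarrow> 'k::field) \<Rightarrow> 'b list \<Rightarrow> 'k) \<Rightarrow> 'a set set \<Rightarrow> 'b set set \<Rightarrow> bool" where
  "chain_map t K L \<longleftrightarrow>
     (\<forall>n. \<forall>c\<in>oriented_chains n K.
        t c \<in> oriented_chains n L \<and> chain_bd (t c) = t (chain_bd c) \<and>
        (\<forall>d\<in>oriented_chains n K. t (\<lambda>x. c x + d x) = (\<lambda>x. t c x + t d x)) \<and>
        (\<forall>a. t (\<lambda>x. a * c x) = (\<lambda>x. a * t c x)))"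

lemma chain_mapD:
  assumes "chain_map t K L" "c \<in> oriented_chains n K"
  shows "t c \<in> oriented_chains n L" and "chain_bd (t c) = t (chain_bd c)"
    and "d \<in> oriented_chains n K \<Longrightarrow> t (\<lambda>x. c x + d x) = (\<lambda>x. t c x + t d x)"
    and "t (\<lambda>x. a * c x) = (\<lambda>x. a * t c x)"
  using assms unfolding chain_map_def by blast+

lemma cycle_is_chain: "c \<in> cycles n K \<Longrightarrow> c \<in> oriented_chains n K"
  by (simp add: cycles_def)

lemma chain_map_cycle:
  assumes t: "chain_map t K L" and c: "c \<in> cycles n K"
  shows "t c \<in> cycles n L"
proof -
  have "t (\<lambda>_. 0) = (\<lambda>_. 0)"
    using chain_mapD(4)[OF t cycle_is_chain[OF c], of 0] by simp
  then show ?thesis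
    using c chain_mapD(1,2)[OF t cycle_is_chain[OF c]] by (simp add: cycles_def)
qed

lemma chain_map_boundary:
  assumes t: "chain_map t K L" and b: "b \<in> boundaries n K"
  shows "t b \<in> boundaries n L"
proof -
  from b obtain c where c: "c \<in> oriented_chains (Suc n) K" "b = chain_bd c"
    unfolding boundaries_def by blast
  then show ?thesis
    using chain_mapD(1,2)[OF t c(1)] unfolding boundaries_def by (metis imageI)
qed

lemma oriented_chains_mono: "K \<subseteq> L \<Longrightarrow> oriented_chains n K \<subseteq> oriented_chains n L"
  unfolding oriented_chains_def by blast

lemma chain_map_id: "K \<subseteq> L \<Longrightarrow> chain_map (\<lambda>c. c) K L"
  unfolding chain_map_def using oriented_chains_mono by blast

lemma pushforward_oriented_chain:
  assumes c: "c \<in> oriented_chains n K" and h: "\<And>\<sigma>. \<sigma> \<in> K \<Longrightarrow> h ` \<sigma> \<in> L"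
  shows "pushforward V h c \<in> oriented_chains n L"
proof -
  have "{ys. pushforward V h c ys \<noteq> 0} \<subseteq> map h ` {xs. c xs \<noteq> 0}"
    using pushforward_nonzero[of V h c] by blast
  then have "finite {ys. pushforward V h c ys \<noteq> 0}"
    by (rule finite_subset) (simp add: finite_support[OF c])
  moreover have "length ys = Suc n \<and> set ys \<in> L" if nz: "pushforward V h c ys \<noteq> 0" for ys
  proof -
    obtain xs where "ys = map h xs" "c xs \<noteq> 0" using pushforward_nonzero[OF nz] by blast
    moreover from this have "length xs = Suc n" "set xs \<in> K"
      using c unfolding oriented_chains_iff by blast+
    ultimately show ?thesis using h by simp
  qed
  moreover have "alternating (pushforward V h c)"
    using c by (intro alternating_pushforward) (simp add: oriented_chains_iff)
  ultimately show ?thesis unfolding oriented_chains_iff by blast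
qed

lemma chain_bd_pushforward:
  assumes c: "c \<in> oriented_chains n K" and V: "finite V" "\<And>\<sigma>. \<sigma> \<in> K \<Longrightarrow> \<sigma> \<subseteq> V"
  shows "chain_bd (pushforward V h c) = pushforward V h (chain_bd c)"
proof
  fix ys
  have bd: "chain_bd c xs = (if xs = [] then 0 else augmented_bd V c xs)" for xs
    by (rule chain_bd_eq_augmented_bd[OF V(1) support_subset_vertices[OF c V(2)]])
  have supp: "set zs \<subseteq> h ` V" if nz: "pushforward V h c zs \<noteq> 0" for zs
    using pushforward_nonzero[OF nz] by (metis image_mono set_map)
  show "chain_bd (pushforward V h c) ys = pushforward V h (chain_bd c) ys"
  proof (cases "ys = []")
    case True
    then show ?thesis by (simp add: chain_bd_def)
  next
    case False
    have "chain_bd (pushforward V h c) ys = augmented_bd (h ` V) (pushforward V h c) ys"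
      using chain_bd_eq_augmented_bd[of "h ` V" "pushforward V h c" ys, OF _ supp] V(1) False by simp
    also have "\<dots> = pushforward V h (augmented_bd V c) ys"
      using V(1) by (intro augmented_bd_pushforward) auto
    also have "\<dots> = pushforward V h (chain_bd c) ys"
    proof (rule ccontr)
      assume "pushforward V h (augmented_bd V c) ys \<noteq> pushforward V h (chain_bd c) ys"
      then have "pushforward V h (\<lambda>xs. augmented_bd V c xs - chain_bd c xs) ys \<noteq> 0"
        by (simp add: pushforward_diff)
      from pushforward_nonzero[OF this] False show False by (auto simp: bd split: if_splits)
    qed
    finally show ?thesis .
  qed
qed

lemma chain_map_pushforward:
  assumes "finite V" "\<And>\<sigma>. \<sigma> \<in> K \<Longrightarrow> \<sigma> \<subseteq> V" "\<And>\<sigma>. \<sigma> \<in> K \<Longrightarrow> h ` \<sigma> \<in> L"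
  shows "chain_map (pushforward V h) K L"
  unfolding chain_map_def
  using assms by (auto simp: pushforward_add pushforward_smult intro: pushforward_oriented_chain chain_bd_pushforward)

section \<open>Contiguous vertex maps\<close>

text \<open>
With \<open>w\<close> the image of the link of \<open>v\<close>, the difference is \<open>h' v * w - h v * w\<close>, and
\<open>\<partial> (h v * h' v * w) = h' v * w - h v * (w - h' v * \<partial> w)\<close>. Now \<open>\<partial> w = 0\<close>, because the boundary of the link
is up to sign the link of the boundary, and \<open>c\<close> is a cycle. The simplices of
\<open>h v * h' v * w\<close> are the sets \<open>h ` \<sigma> \<union> h' ` \<sigma>\<close> for simplices \<open>\<sigma>\<close> containing \<open>v\<close>.
\<close>

lemma pushforward_change_vertex_homologous:
  assumes V: "finite V" "\<And>\<sigma>. \<sigma> \<in> K \<Longrightarrow> \<sigma> \<subseteq> V" and c: "c \<in> cycles n K"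
    and v: "v \<in> V" and hh': "\<And>x. x \<noteq> v \<Longrightarrow> h' x = h x"
    and L: "\<And>\<sigma>. \<sigma> \<in> K \<Longrightarrow> h ` \<sigma> \<union> h' ` \<sigma> \<in> L"
  shows "(\<lambda>ys. pushforward V h' c ys - pushforward V h c ys) \<in> boundaries n L"
proof -
  have ch: "c \<in> oriented_chains n K" and cyc: "chain_bd c = (\<lambda>_. 0)"
    using c by (simp_all add: cycles_def)
  have alt: "alternating c" using ch by (simp add: oriented_chains_iff)
  define w where "w = pushforward V h (\<lambda>ys. c (v # ys))"
  define b where "b = vertex_cone (h v) (vertex_cone (h' v) w)"
  define W where "W = h ` V \<union> {h' v}"
  have W: "finite W" "h ` V \<subseteq> W" "h v \<in> W" "h' v \<in> W" using V v by (auto simp: W_def)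
  \<comment> \<open>a simplex of the join \<open>b\<close> consists of \<open>h v\<close>, \<open>h' v\<close> and the image of a simplex of the link\<close>
  have b_supp: "length zs = Suc (Suc n) \<and> set zs \<in> L \<and> set zs \<subseteq> W" if nz: "b zs \<noteq> 0" for zs
  proof -
    obtain us vs where zs: "zs = us @ h v # vs" and "vertex_cone (h' v) w (us @ vs) \<noteq> 0"
      using vertex_cone_nonzero[OF nz[unfolded b_def]] by blast
    from vertex_cone_nonzero[OF this(2)] obtain us' vs'
      where uv: "us @ vs = us' @ h' v # vs'" and "w (us' @ vs') \<noteq> 0" by blast
    from pushforward_nonzero[OF this(2)[unfolded w_def]] obtain xs
      where xs: "map h xs = us' @ vs'" "c (v # xs) \<noteq> 0" "set xs \<subseteq> V" by blast
    have \<sigma>: "set (v # xs) \<in> K" "length (v # xs) = Suc n"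
      using ch xs(2) unfolding oriented_chains_iff by blast+
    have "length zs = Suc (length (us @ vs))" by (simp add: zs)
    also have "\<dots> = Suc (Suc (length (us' @ vs')))" unfolding uv by simp
    also have "\<dots> = Suc (Suc n)" using \<sigma>(2) unfolding xs(1)[symmetric] by simp
    finally have len: "length zs = Suc (Suc n)" .
    have "set zs = insert (h v) (set (us @ vs))" by (auto simp: zs)
    also have "\<dots> = insert (h v) (insert (h' v) (set (us' @ vs')))" unfolding uv by auto
    also have "\<dots> = insert (h v) (insert (h' v) (h ` set xs))"
      unfolding xs(1)[symmetric] by simp
    finally have set_zs: "set zs = insert (h v) (insert (h' v) (h ` set xs))" .
    also have "\<dots> = h ` set (v # xs) \<union> h' ` set (v # xs)"
    proof -
      have "h' x \<in> insert (h' v) (h ` set xs)" if "x \<in> set xs" for x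
        using hh'[of x] that by (cases "x = v") auto
      then show ?thesis by auto
    qed
    finally have "set zs \<in> L" using L[OF \<sigma>(1)] by simp
    moreover have "set zs \<subseteq> W" unfolding set_zs W_def using xs(3) v by auto
    ultimately show ?thesis using len by blast
  qed
  have "b \<in> oriented_chains (Suc n) L"
  proof -
    have "finite {zs. b zs \<noteq> 0}"
    proof (rule finite_subset)
      show "{zs. b zs \<noteq> 0} \<subseteq> {zs. set zs \<subseteq> W \<and> length zs = Suc (Suc n)}"
        using b_supp by blast
    qed (simp add: finite_lists_length_eq W(1))
    moreover have "alternating b"
      unfolding b_def w_def
      by (intro alternating_vertex_cone alternating_pushforward alternating_Cons alt)
    ultimately show ?thesis unfolding oriented_chains_iff using b_supp by blast
  qed
  moreover have "chain_bd b = (\<lambda>ys. pushforward V h' c ys - pushforward V h c ys)"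
  proof
    fix ys
    \<comment> \<open>moving \<open>v\<close> past the summation vertex costs a sign and turns the boundary of the link into
        the boundary of \<open>c\<close> at \<open>v # ys\<close>\<close>
    have link: "augmented_bd V (\<lambda>ys. c (v # ys)) = (\<lambda>_. 0)"
    proof
      fix ys
      have "augmented_bd V (\<lambda>ys. c (v # ys)) ys = - (\<Sum>x\<in>V. c (x # v # ys))"
        unfolding augmented_bd_def sum_negf[symmetric]
        by (intro sum.cong refl alternating_adjacent(1)[OF alt, of "[]", unfolded append_Nil])
      also have "\<dots> = - chain_bd c (v # ys)"
        using chain_bd_eq_augmented_bd[of V c "v # ys", OF V(1) support_subset_vertices[OF ch V(2)]]
        by (simp add: augmented_bd_def)
      finally show "augmented_bd V (\<lambda>ys. c (v # ys)) ys = 0" by (simp add: cyc)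
    qed
    have "augmented_bd W w = (\<lambda>_. 0)"
      unfolding w_def by (rule ext, subst augmented_bd_pushforward[OF V(1) W(1,2)]) (simp add: link pushforward_zero)
    then have "augmented_bd W (vertex_cone (h' v) w) = w"
      by (intro ext, subst augmented_bd_vertex_cone[OF W(1,4)]) (simp add: vertex_cone_zero)
    then have bd: "augmented_bd W b ys = vertex_cone (h' v) w ys - vertex_cone (h v) w ys" for ys
      unfolding b_def by (subst augmented_bd_vertex_cone[OF W(1,3)]) simp
    show "chain_bd b ys = pushforward V h' c ys - pushforward V h c ys"
    proof (cases "ys = []")
      case True
      \<comment> \<open>\<^const>\<open>chain_bd\<close> is 0 at the empty list by definition, whereas a pushforward takes the value
          \<open>c []\<close> there\<close>
      have "c [] = 0" using ch unfolding oriented_chains_iff by force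
      with True show ?thesis by (simp add: chain_bd_def)
    next
      case False
      have "chain_bd b ys = augmented_bd W b ys"
        using chain_bd_eq_augmented_bd[of W b ys] W(1) b_supp False by simp
      then show ?thesis
        using pushforward_change_vertex[of c V v h' h ys, OF alt V(1) v hh'] by (simp add: bd w_def)
    qed
  qed
  ultimately show ?thesis unfolding boundaries_def by (metis imageI)
qed

text \<open>
Replace the values of \<open>h\<close> by those of \<open>h'\<close> at one vertex at a time. All intermediate maps send \<open>\<sigma>\<close>
into \<open>h ` \<sigma> \<union> h' ` \<sigma>\<close>, so that any two consecutive ones are contiguous as well.
\<close>

lemma pushforward_contiguous_homologous:
  fixes c :: "'a list \<Rightarrow> 'k::field"
  assumes V: "finite V" "\<And>\<sigma>. \<sigma> \<in> K \<Longrightarrow> \<sigma> \<subseteq> V" and c: "c \<in> cycles n K"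
    and L: "hereditary L" "\<And>\<sigma>. \<sigma> \<in> K \<Longrightarrow> \<sigma> \<noteq> {} \<and> h ` \<sigma> \<union> h' ` \<sigma> \<in> L"
  shows "(\<lambda>ys. pushforward V h' c ys - pushforward V h c ys) \<in> boundaries n L"
proof -
  let ?h = "\<lambda>S x. if x \<in> S then h' x else h x"
  have "(\<lambda>ys. pushforward V (?h S) c ys - pushforward V h c ys) \<in> boundaries n L" if "finite S" "S \<subseteq> V" for S
    using that
  proof (induction S)
    case empty
    then show ?case using function_subspaceD(1)[OF function_subspace_boundaries] by simp
  next
    case (insert v S)
    have "(\<lambda>ys. pushforward V (?h (insert v S)) c ys - pushforward V (?h S) c ys) \<in> boundaries n L"
    proof (rule pushforward_change_vertex_homologous[OF V c, of v])
      fix \<sigma> assume "\<sigma> \<in> K"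
      with L(2) have \<sigma>: "\<sigma> \<noteq> {}" "h ` \<sigma> \<union> h' ` \<sigma> \<in> L" by blast+
      show "?h S ` \<sigma> \<union> ?h (insert v S) ` \<sigma> \<in> L"
      proof (rule hereditaryD[OF L(1) \<sigma>(2)])
        show "?h S ` \<sigma> \<union> ?h (insert v S) ` \<sigma> \<noteq> {}"
          using \<sigma>(1) by (simp only: Un_empty image_is_empty) simp
      qed auto
    qed (use insert in auto)
    from function_subspaceD(2)[OF function_subspace_boundaries this insert.IH] insert.prems
    show ?case by simp
  qed
  from this[OF V(1) order_refl]
  have "(\<lambda>ys. pushforward V (?h V) c ys - pushforward V h c ys) \<in> boundaries n L" .
  moreover have "pushforward V (?h V) c = pushforward V h' c"
    using support_subset_vertices[OF cycle_is_chain[OF c] V(2)] V(1)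
    by (intro ext pushforward_cong) (simp_all, blast)
  ultimately show ?thesis by simp
qed

section \<open>Linear maps on total homology\<close>

definition homology_map ::
    "(('a list \<Rightarrow> 'k::field) \<Rightarrow> 'b list \<Rightarrow> 'k) \<Rightarrow> 'b set set \<Rightarrow>
     (nat \<Rightarrow> ('a list \<Rightarrow> 'k) set) \<Rightarrow> nat \<Rightarrow> ('b list \<Rightarrow> 'k) set" where
  "homology_map t L h = (\<lambda>n. \<Union>c\<in>h n. coset (boundaries n L) (t c))"

lemma homology_incl_eq_homology_map: "homology_incl L = homology_map (\<lambda>c. c) L"
  by (intro ext) (simp add: homology_incl_def homology_map_def homology_coset)

lemma homology_map_coset:
  assumes t: "chain_map t K L" and K: "hereditary K" and c: "c \<in> cycles n K"
    and h: "h n = coset (boundaries n K) c"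
  shows "homology_map t L h n = coset (boundaries n L) (t c)"
proof -
  note cosetL = coset_eq_iff[OF function_subspace_boundaries[of n L]]
  have "coset (boundaries n L) (t (\<lambda>x. b x + c x)) = coset (boundaries n L) (t c)"
    if b: "b \<in> boundaries n K" for b
  proof -
    have "b \<in> oriented_chains n K"
      using b boundaries_subset_cycles[OF K] cycle_is_chain by blast
    then have "t (\<lambda>x. b x + c x) = (\<lambda>x. t b x + t c x)"
      using chain_mapD(3)[OF t _ cycle_is_chain[OF c]] by blast
    then show ?thesis using chain_map_boundary[OF t b] by (simp add: cosetL)
  qed
  moreover have "boundaries n K \<noteq> {}"
    using function_subspaceD(1)[OF function_subspace_boundaries] by blast
  ultimately show ?thesis
    unfolding homology_map_def h coset_def[of "boundaries n K"] by auto
qed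

lemma total_homology_representatives:
  assumes "h \<in> carrier (total_homology K)"
  obtains c where "\<And>n. c n \<in> cycles n K" "\<And>n. h n = coset (boundaries n K) (c n)"
proof -
  have "\<exists>c\<in>cycles n K. h n = coset (boundaries n K) c" for n
    using assms by (auto simp: total_homology_def direct_sum_space_def homology_space_carrier)
  then show ?thesis using that by metis
qed

text \<open>
In each degree the map is \<open>[c] \<mapsto> [t c]\<close> on classes. It preserves the zero class, hence finiteness of
the support of an element of the direct sum.
\<close>

lemma linear_map_homology_map:
  fixes t :: "('a list \<Rightarrow> 'k::field) \<Rightarrow> 'b list \<Rightarrow> 'k"
  assumes t: "chain_map t K L" and K: "hereditary K" and L: "hereditary L"
  shows "linear_map class_ring (total_homology K) (total_homology L) (homology_map t L)"
proof -
  let ?K = "total_homology K :: ('k, nat \<Rightarrow> ('a list \<Rightarrow> 'k) set) module"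
  let ?L = "total_homology L :: ('k, nat \<Rightarrow> ('b list \<Rightarrow> 'k) set) module"
  note map = homology_map_coset[OF t K]
  have closed: "homology_map t L h \<in> carrier ?L" if h: "h \<in> carrier ?K" for h
  proof -
    obtain c where c: "\<And>n. c n \<in> cycles n K" "\<And>n. h n = coset (boundaries n K) (c n)"
      using total_homology_representatives[OF h] by blast
    have "homology_map t L h n \<in> carrier (homology_space n L)" for n
      using map[of "c n" n h, OF c] chain_map_cycle[OF t c(1)[of n]] by (simp add: homology_space_carrier)
    moreover have "finite {n. homology_map t L h n \<noteq> \<zero>\<^bsub>homology_space n L\<^esub>}"
    proof (rule finite_subset)
      show "{n. homology_map t L h n \<noteq> \<zero>\<^bsub>homology_space n L\<^esub>}
          \<subseteq> {n. h n \<noteq> \<zero>\<^bsub>homology_space n K\<^esub>}"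
      proof (rule Collect_mono, rule impI, rule notI)
        fix n
        assume nz: "homology_map t L h n \<noteq> \<zero>\<^bsub>homology_space n L\<^esub>"
          and "h n = \<zero>\<^bsub>homology_space n K\<^esub>"
        then have hn: "h n = coset (boundaries n K) (\<lambda>_. 0)"
          by (simp add: homology_space_zero zero_coset)
        have "t (\<lambda>_. 0) = (\<lambda>_. 0)"
          using chain_mapD(4)[OF t cycle_is_chain[OF c(1)], of 0] by simp
        then have "homology_map t L h n = \<zero>\<^bsub>homology_space n L\<^esub>"
          using map[of "\<lambda>_. 0" n h] hn function_subspaceD(1)[OF function_subspace_cycles[of n K]]
          by (simp add: homology_space_zero zero_coset)
        with nz show False by simp
      qed
      show "finite {n. h n \<noteq> \<zero>\<^bsub>homology_space n K\<^esub>}"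
        using h by (simp add: total_homology_def direct_sum_space_def)
    qed
    ultimately show ?thesis by (simp add: total_homology_def direct_sum_space_def)
  qed
  have add: "homology_map t L (g \<oplus>\<^bsub>?K\<^esub> h) = homology_map t L g \<oplus>\<^bsub>?L\<^esub> homology_map t L h"
    if g: "g \<in> carrier ?K" and h: "h \<in> carrier ?K" for g h
  proof
    fix n
    obtain c where c: "\<And>n. c n \<in> cycles n K" "\<And>n. g n = coset (boundaries n K) (c n)"
      using total_homology_representatives[OF g] by blast
    obtain d where d: "\<And>n. d n \<in> cycles n K" "\<And>n. h n = coset (boundaries n K) (d n)"
      using total_homology_representatives[OF h] by blast
    have "(g \<oplus>\<^bsub>?K\<^esub> h) n = coset (boundaries n K) (\<lambda>x. c n x + d n x)"
      by (simp add: total_homology_def direct_sum_space_def c(2) d(2) homology_space_add)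
    then have "homology_map t L (g \<oplus>\<^bsub>?K\<^esub> h) n = coset (boundaries n L) (t (\<lambda>x. c n x + d n x))"
      by (intro map function_subspaceD(2)[OF function_subspace_cycles] c d)
    also have "t (\<lambda>x. c n x + d n x) = (\<lambda>x. t (c n) x + t (d n) x)"
      by (rule chain_mapD(3)[OF t cycle_is_chain[OF c(1)] cycle_is_chain[OF d(1)]])
    finally show "homology_map t L (g \<oplus>\<^bsub>?K\<^esub> h) n
        = (homology_map t L g \<oplus>\<^bsub>?L\<^esub> homology_map t L h) n"
      by (simp add: total_homology_def direct_sum_space_def homology_space_add
          map[of "c n" n g, OF c] map[of "d n" n h, OF d])
  qed
  have smult: "homology_map t L (a \<odot>\<^bsub>?K\<^esub> h) = a \<odot>\<^bsub>?L\<^esub> homology_map t L h"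
    if h: "h \<in> carrier ?K" for a h
  proof
    fix n
    obtain d where d: "\<And>n. d n \<in> cycles n K" "\<And>n. h n = coset (boundaries n K) (d n)"
      using total_homology_representatives[OF h] by blast
    have "(a \<odot>\<^bsub>?K\<^esub> h) n = coset (boundaries n K) (\<lambda>x. a * d n x)"
      by (simp add: total_homology_def direct_sum_space_def d(2) homology_space_smult)
    then have "homology_map t L (a \<odot>\<^bsub>?K\<^esub> h) n = coset (boundaries n L) (t (\<lambda>x. a * d n x))"
      by (intro map function_subspaceD(3)[OF function_subspace_cycles] d)
    also have "t (\<lambda>x. a * d n x) = (\<lambda>x. a * t (d n) x)"
      by (rule chain_mapD(4)[OF t cycle_is_chain[OF d(1)]])
    finally show "homology_map t L (a \<odot>\<^bsub>?K\<^esub> h) n = (a \<odot>\<^bsub>?L\<^esub> homology_map t L h) n"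
      by (simp add: total_homology_def direct_sum_space_def homology_space_smult
          map[of "d n" n h, OF d])
  qed
  have "homology_map t L \<in> module_hom class_ring ?K ?L"
    unfolding module_hom_def using closed add smult by auto
  then show ?thesis
    using vectorspace_total_homology[OF K] vectorspace_total_homology[OF L]
    by (intro linear_map.intro mod_hom.intro mod_hom_axioms.intro vectorspace.axioms(1))
qed

lemma chain_map_comp:
  fixes t :: "('a list \<Rightarrow> 'k::field) \<Rightarrow> 'b list \<Rightarrow> 'k" and u :: "('b list \<Rightarrow> 'k) \<Rightarrow> 'c list \<Rightarrow> 'k"
  assumes t: "chain_map t K L" and u: "chain_map u L M"
  shows "chain_map (u \<circ> t) K M"
  unfolding chain_map_def comp_def
proof (intro allI ballI conjI)
  fix n and c :: "'a list \<Rightarrow> 'k"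
  assume c: "c \<in> oriented_chains n K"
  note tc = chain_mapD[OF t c] and utc = chain_mapD[OF u chain_mapD(1)[OF t c]]
  show "u (t c) \<in> oriented_chains n M" by (rule utc(1))
  show "chain_bd (u (t c)) = u (t (chain_bd c))" by (simp only: utc(2) tc(2))
  show "u (t (\<lambda>x. a * c x)) = (\<lambda>x. a * u (t c) x)" for a by (simp only: tc(4) utc(4))
  fix d :: "'a list \<Rightarrow> 'k"
  assume d: "d \<in> oriented_chains n K"
  show "u (t (\<lambda>x. c x + d x)) = (\<lambda>x. u (t c) x + u (t d) x)"
    by (simp only: tc(3)[OF d] utc(3)[OF chain_mapD(1)[OF t d]])
qed

lemma homology_map_comp:
  assumes t: "chain_map t K L" and u: "chain_map u L M" and K: "hereditary K" and L: "hereditary L"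
    and h: "h \<in> carrier (total_homology K)"
  shows "homology_map u M (homology_map t L h) = homology_map (u \<circ> t) M h"
proof
  fix n
  obtain c where c: "\<And>n. c n \<in> cycles n K" "\<And>n. h n = coset (boundaries n K) (c n)"
    using total_homology_representatives[OF h] by blast
  show "homology_map u M (homology_map t L h) n = homology_map (u \<circ> t) M h n"
    unfolding homology_map_coset[of "u \<circ> t" K M "c n" n h, OF chain_map_comp[OF t u] K c]
    by (simp add: homology_map_coset[of u L M "t (c n)" n "homology_map t L h", OF u L chain_map_cycle[OF t c(1)]
          homology_map_coset[of t K L "c n" n h, OF t K c]])
qed

lemma homology_map_cong:
  assumes t: "chain_map t K L" and u: "chain_map u K L" and K: "hereditary K"
    and tu: "\<And>n c. c \<in> cycles n K \<Longrightarrow> (\<lambda>x. t c x - u c x) \<in> boundaries n L"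
    and h: "h \<in> carrier (total_homology K)"
  shows "homology_map t L h = homology_map u L h"
proof
  fix n
  obtain c where c: "\<And>n. c n \<in> cycles n K" "\<And>n. h n = coset (boundaries n K) (c n)"
    using total_homology_representatives[OF h] by blast
  show "homology_map t L h n = homology_map u L h n"
    unfolding homology_map_coset[of t K L "c n" n h, OF t K c]
      homology_map_coset[of u K L "c n" n h, OF u K c]
      coset_eq_iff[OF function_subspace_boundaries]
    by (rule tu[OF c(1)])
qed

section \<open>Connected components\<close>

lemma hereditary_edgeD:
  assumes "hereditary K" "(x, y) \<in> edges K"
  shows "x \<in> vertices K" "y \<in> vertices K" "(y, x) \<in> edges K"
  using assms hereditaryD[OF assms(1), of "{x, y}"]
  by (auto simp: edges_def vertices_def insert_commute)

text \<open>
Edges run between vertices and there is a loop at each vertex, so the transitive closure is already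
reflexive on the vertices.
\<close>

lemma equiv_connected:
  assumes K: "hereditary K"
  shows "equiv (vertices K) ((edges K)\<^sup>+)"
proof (rule equivI)
  have "edges K \<subseteq> vertices K \<times> vertices K" using hereditary_edgeD[OF K] by auto
  then show "(edges K)\<^sup>+ \<subseteq> vertices K \<times> vertices K" by (rule trancl_subset_Sigma)
  show "refl_on (vertices K) ((edges K)\<^sup>+)"
    by (rule refl_onI) (auto simp: edges_def vertices_def)
  show "sym ((edges K)\<^sup>+)"
    by (rule sym_trancl) (auto simp: sym_def dest: hereditary_edgeD(3)[OF K])
qed (rule trans_trancl)

lemma pi0_nonempty: "hereditary K \<Longrightarrow> A \<in> pi0 K \<Longrightarrow> A \<noteq> {}"
  unfolding pi0_def by (metis equiv_connected in_quotient_imp_non_empty)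

lemma pi0_subset: "hereditary K \<Longrightarrow> A \<in> pi0 K \<Longrightarrow> A \<subseteq> vertices K"
  unfolding pi0_def by (metis equiv_connected in_quotient_imp_subset)

lemma component_containing_eq:
  assumes L: "hereditary L" and B: "B \<in> pi0 L" and A: "A \<noteq> {}" "A \<subseteq> B"
  shows "component_containing L A = B"
  unfolding component_containing_def
proof (rule the_equality)
  fix C assume "C \<in> pi0 L \<and> A \<subseteq> C"
  then show "C = B"
    using quotient_disj[OF equiv_connected[OF L], of B C] A B unfolding pi0_def by blast
qed (use assms in blast)

text \<open>
A simplicial map sends paths to paths, so the image of a component is nonempty and connected and
lies in exactly one component.
\<close>

lemma component_image:
  assumes K: "hereditary K" and L: "hereditary L" and h: "\<And>\<sigma>. \<sigma> \<in> K \<Longrightarrow> h ` \<sigma> \<in> L"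
    and A: "A \<in> pi0 K"
  shows "component_containing L (h ` A) \<in> pi0 L" "h ` A \<subseteq> component_containing L (h ` A)"
proof -
  obtain x where x: "x \<in> vertices K" "A = (edges K)\<^sup>+ `` {x}"
    using A unfolding pi0_def by (auto elim: quotientE)
  have step: "(h y, h z) \<in> edges L" if "(y, z) \<in> edges K" for y z
    using h[of "{y, z}"] that by (simp add: edges_def)
  have path: "(h x, h y) \<in> (edges L)\<^sup>+" if "(x, y) \<in> (edges K)\<^sup>+" for y
    using that by (induction) (auto dest: step intro: trancl_into_trancl)
  have "h x \<in> vertices L" using h[of "{x}"] x(1) by (simp add: vertices_def)
  then have B: "(edges L)\<^sup>+ `` {h x} \<in> pi0 L" unfolding pi0_def by (rule quotientI)
  have sub: "h ` A \<subseteq> (edges L)\<^sup>+ `` {h x}" using path x(2) by auto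
  have "component_containing L (h ` A) = (edges L)\<^sup>+ `` {h x}"
    using pi0_nonempty[OF K A] by (intro component_containing_eq[OF L B _ sub]) simp
  then show "component_containing L (h ` A) \<in> pi0 L" "h ` A \<subseteq> component_containing L (h ` A)"
    using B sub by simp_all
qed

lemma hereditary_VR: "hereditary (VR A d s)"
  unfolding hereditary_def VR_def by blast

lemma hereditary_level_complex: "hereditary (level_complex X d f r U)"
  using hereditary_VR[of X d r] unfolding hereditary_def level_complex_def full_subcomplex_def
  by blast

lemma level_complex_iff:
  "\<sigma> \<in> level_complex X d f r U \<longleftrightarrow>
     \<sigma> \<noteq> {} \<and> \<sigma> \<subseteq> X \<and> (\<forall>x\<in>\<sigma>. f x \<in> U) \<and> (\<forall>x\<in>\<sigma>. \<forall>x'\<in>\<sigma>. d x x' \<le> 2 * r)"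
  unfolding level_complex_def full_subcomplex_def VR_def by blast

lemma component_subset:
  assumes "A \<in> pi0 (level_complex X d f r U)"
  shows "A \<subseteq> {x \<in> X. f x \<in> U \<and> d x x \<le> 2 * r}"
  using pi0_subset[OF hereditary_level_complex assms]
  by (auto simp: vertices_def level_complex_iff)

section \<open>Morphisms of decorated Reeb graphs from vertex maps\<close>

text \<open>
The map \<open>t\<close> realises \<open>h\<close> on chains for all complexes at once. This treats pushforwards and the
identity, which underlies the structure morphisms, on the same footing; the pushforward
along the identity coincides with the identity only on chains over \<open>X\<close>.
\<close>

definition lifts_to_chains ::
    "'a set \<Rightarrow> ('a \<Rightarrow> 'b) \<Rightarrow> (('a list \<Rightarrow> 'k::field) \<Rightarrow> 'b list \<Rightarrow> 'k) \<Rightarrow> bool" where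
  "lifts_to_chains X h t \<longleftrightarrow>
     (\<forall>K L. (\<forall>\<sigma>\<in>K. \<sigma> \<subseteq> X \<and> h ` \<sigma> \<in> L) \<longrightarrow> chain_map t K L)"

lemma lifts_to_chains_id: "lifts_to_chains X (\<lambda>x. x) (\<lambda>c. c)"
  unfolding lifts_to_chains_def by (auto intro!: chain_map_id)

lemma lifts_to_chains_pushforward: "finite X \<Longrightarrow> lifts_to_chains X h (pushforward X h)"
  unfolding lifts_to_chains_def by (auto intro!: chain_map_pushforward)

text \<open>
The map \<open>h\<close> sends the level complex at \<open>(fst p, U)\<close> into the one at \<open>(fst q, V)\<close>, and the
Vietoris-Rips complexes at scale \<open>snd p\<close> into those at scale \<open>snd q\<close>.
\<close>

definition respects_scales ::
    "'a set \<Rightarrow> ('a \<Rightarrow> 'a \<Rightarrow> real) \<Rightarrow> ('a \<Rightarrow> real) \<Rightarrow> real \<times> real \<Rightarrow> real set \<Rightarrow> ('a \<Rightarrow> 'b) \<Rightarrow>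
     'b set \<Rightarrow> ('b \<Rightarrow> 'b \<Rightarrow> real) \<Rightarrow> ('b \<Rightarrow> real) \<Rightarrow> real \<times> real \<Rightarrow> real set \<Rightarrow> bool" where
  "respects_scales X dX f p U h Y dY g q V \<longleftrightarrow>
     (\<forall>x\<in>X. h x \<in> Y \<and> (f x \<in> U \<longrightarrow> g (h x) \<in> V)) \<and>
     (\<forall>x\<in>X. \<forall>x'\<in>X. (dX x x' \<le> 2 * fst p \<longrightarrow> dY (h x) (h x') \<le> 2 * fst q) \<and>
        (dX x x' \<le> 2 * snd p \<longrightarrow> dY (h x) (h x') \<le> 2 * snd q))"

text \<open>
The morphism of \<open>PVec\<close> induced by a vertex map \<open>h\<close> that \<open>t\<close> realises on chains. As for the structure morphisms, the parameters of
the source do not enter into the function.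
\<close>

definition reeb_morphism ::
    "('a \<Rightarrow> 'b) \<Rightarrow> (('a list \<Rightarrow> 'k::field) \<Rightarrow> 'b list \<Rightarrow> 'k) \<Rightarrow>
     'b set \<Rightarrow> ('b \<Rightarrow> 'b \<Rightarrow> real) \<Rightarrow> ('b \<Rightarrow> real) \<Rightarrow> real \<times> real \<Rightarrow> real set \<Rightarrow>
     ('a set, 'b set, nat \<Rightarrow> ('a list \<Rightarrow> 'k) set, nat \<Rightarrow> ('b list \<Rightarrow> 'k) set) pvec_map" where
  "reeb_morphism h t Y d g q V =
     (let comp = (\<lambda>A. component_containing (level_complex Y d g (fst q) V) (h ` A))
      in \<lparr>on_idx = comp, on_fibre = (\<lambda>A. homology_map t (VR (comp A) d (snd q)))\<rparr>)"

lemma reeb_map_eq_reeb_morphism: "reeb_map X d f q V = reeb_morphism (\<lambda>x. x) (\<lambda>c. c) X d f q V"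
  by (simp add: reeb_map_def reeb_morphism_def Let_def homology_incl_eq_homology_map split: prod.split)

lemma idx_reeb_ob: "idx (reeb_ob X d f p U) = pi0 (level_complex X d f (fst p) U)"
  by (simp add: reeb_ob_def split: prod.split)

lemma fibre_reeb_ob: "fibre (reeb_ob X d f p U) A = total_homology (VR A d (snd p))"
  by (simp add: reeb_ob_def split: prod.split)

lemma reeb_morphism_component:
  assumes ne: "respects_scales X dX f p U h Y dY g q V"
    and A: "A \<in> pi0 (level_complex X dX f (fst p) U)"
  shows "on_idx (reeb_morphism h t Y dY g q V) A \<in> pi0 (level_complex Y dY g (fst q) V)"
    and "h ` A \<subseteq> on_idx (reeb_morphism h t Y dY g q V) A"
proof -
  have "h ` \<sigma> \<in> level_complex Y dY g (fst q) V" if "\<sigma> \<in> level_complex X dX f (fst p) U" for \<sigma>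
    using that ne unfolding level_complex_iff respects_scales_def by blast
  note C = component_image[OF hereditary_level_complex hereditary_level_complex this A]
  then show "on_idx (reeb_morphism h t Y dY g q V) A \<in> pi0 (level_complex Y dY g (fst q) V)"
    and "h ` A \<subseteq> on_idx (reeb_morphism h t Y dY g q V) A"
    by (simp_all add: reeb_morphism_def Let_def)
qed

lemma chain_map_VR:
  assumes ne: "respects_scales X dX f p U h Y dY g q V" and t: "lifts_to_chains X h t"
    and A: "A \<subseteq> X" and B: "h ` A \<subseteq> B"
  shows "chain_map t (VR A dX (snd p)) (VR B dY (snd q))"
proof -
  have "\<sigma> \<subseteq> X \<and> h ` \<sigma> \<in> VR B dY (snd q)" if "\<sigma> \<in> VR A dX (snd p)" for \<sigma>
  proof
    show "\<sigma> \<subseteq> X" using that A unfolding VR_def by blast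
    with that show "h ` \<sigma> \<in> VR B dY (snd q)"
      using ne B unfolding VR_def respects_scales_def by blast
  qed
  then show ?thesis using t unfolding lifts_to_chains_def by blast
qed

lemma reeb_morphism_hom:
  assumes ne: "respects_scales X dX f p U h Y dY g q V" and t: "lifts_to_chains X h t"
  shows "reeb_morphism h t Y dY g q V \<in> pvec_hom (reeb_ob X dX f p U) (reeb_ob Y dY g q V)"
  unfolding pvec_hom_def
proof (intro CollectI ballI conjI)
  fix A assume "A \<in> idx (reeb_ob X dX f p U)"
  then have A: "A \<in> pi0 (level_complex X dX f (fst p) U)" by (simp add: idx_reeb_ob)
  let ?m = "reeb_morphism h t Y dY g q V"
  note C = reeb_morphism_component[OF ne A, of t]
  show "on_idx ?m A \<in> idx (reeb_ob Y dY g q V)" using C(1) by (simp add: idx_reeb_ob)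
  have "A \<subseteq> X" using component_subset[OF A] by blast
  then have "chain_map t (VR A dX (snd p)) (VR (on_idx ?m A) dY (snd q))"
    by (rule chain_map_VR[OF ne t _ C(2)])
  from linear_map_homology_map[OF this hereditary_VR hereditary_VR]
  show "linear_map class_ring (fibre (reeb_ob X dX f p U) A)
      (fibre (reeb_ob Y dY g q V) (on_idx ?m A)) (on_fibre ?m A)"
    unfolding fibre_reeb_ob by (simp add: reeb_morphism_def Let_def)
qed

lemma respects_scales_comp:
  assumes "respects_scales X dX f p U h Y dY g q V" "respects_scales Y dY g q V k Z dZ e r W"
  shows "respects_scales X dX f p U (k \<circ> h) Z dZ e r W"
  using assms unfolding respects_scales_def comp_def by blast

text \<open>
On indices, both sides yield the component that contains the image of \<open>A\<close>, which is unique.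
On fibres this is functoriality of homology.
\<close>

lemma reeb_morphism_comp:
  fixes t :: "('a list \<Rightarrow> 'k::field) \<Rightarrow> 'b list \<Rightarrow> 'k"
  assumes h: "respects_scales X dX f p U h Y dY g q V" and t: "lifts_to_chains X h t"
    and k: "respects_scales Y dY g q V k Z dZ e r W" and u: "lifts_to_chains Y k u"
  shows "pvec_eq (reeb_ob X dX f p U) (reeb_morphism k u Z dZ e r W \<circ>\<^sub>P reeb_morphism h t Y dY g q V)
    (reeb_morphism (k \<circ> h) (u \<circ> t) Z dZ e r W)"
  unfolding pvec_eq_def
proof (intro ballI conjI)
  fix A assume "A \<in> idx (reeb_ob X dX f p U)"
  then have A: "A \<in> pi0 (level_complex X dX f (fst p) U)" by (simp add: idx_reeb_ob)
  let ?h = "reeb_morphism h t Y dY g q V" and ?k = "reeb_morphism k u Z dZ e r W"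
    and ?kh = "reeb_morphism (k \<circ> h) (u \<circ> t) Z dZ e r W"
  define B where "B = on_idx ?h A"
  define C where "C = on_idx ?k B"
  note hB = reeb_morphism_component[OF h A, of t, folded B_def]
  note kC = reeb_morphism_component[OF k hB(1), of u, folded C_def]
  have khC: "(k \<circ> h) ` A \<subseteq> C" using hB(2) kC(2) by auto
  have A_ne: "A \<noteq> {}" by (rule pi0_nonempty[OF hereditary_level_complex A])
  have "component_containing (level_complex Z dZ e (fst r) W) ((k \<circ> h) ` A) = C"
    using A_ne by (intro component_containing_eq hereditary_level_complex kC(1) khC) simp
  then have idx: "on_idx ?kh A = C" by (simp add: reeb_morphism_def Let_def)
  then show "on_idx (?k \<circ>\<^sub>P ?h) A = on_idx ?kh A"
    by (simp add: pvec_comp_def B_def C_def)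
  fix v :: "nat \<Rightarrow> ('a list \<Rightarrow> 'k) set"
  assume "v \<in> carrier (fibre (reeb_ob X dX f p U) A)"
  then have v: "v \<in> carrier (total_homology (VR A dX (snd p)))" by (simp add: fibre_reeb_ob)
  have "A \<subseteq> X" "B \<subseteq> Y" using component_subset[OF A] component_subset[OF hB(1)] by blast+
  then have t': "chain_map t (VR A dX (snd p)) (VR B dY (snd q))"
    and u': "chain_map u (VR B dY (snd q)) (VR C dZ (snd r))"
    using chain_map_VR[OF h t _ hB(2)] chain_map_VR[OF k u _ kC(2)] by blast+
  have "on_fibre (?k \<circ>\<^sub>P ?h) A v
      = homology_map u (VR C dZ (snd r)) (homology_map t (VR B dY (snd q)) v)"
    by (simp add: pvec_comp_def C_def B_def reeb_morphism_def Let_def)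
  also have "\<dots> = homology_map (u \<circ> t) (VR C dZ (snd r)) v"
    by (rule homology_map_comp[OF t' u' hereditary_VR hereditary_VR v])
  also have "\<dots> = on_fibre ?kh A v"
    using idx by (simp add: reeb_morphism_def Let_def)
  finally show "on_fibre (?k \<circ>\<^sub>P ?h) A v = on_fibre ?kh A v" .
qed

lemma pvec_eq_sym: "pvec_eq P m n \<Longrightarrow> pvec_eq P n m"
  unfolding pvec_eq_def by simp

lemma pvec_eq_trans: "pvec_eq P l m \<Longrightarrow> pvec_eq P m n \<Longrightarrow> pvec_eq P l n"
  unfolding pvec_eq_def by simp

lemma pi0_edge_closed:
  assumes "C \<in> pi0 L" "x \<in> C" "(x, y) \<in> edges L"
  shows "y \<in> C"
  using assms unfolding pi0_def by (auto elim!: quotientE intro: trancl_into_trancl)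

lemma respects_scales_id:
  assumes "p \<le> q" "U \<subseteq> V"
  shows "respects_scales X d f p U (\<lambda>x. x) X d f q V"
  using assms unfolding respects_scales_def by (auto simp: less_eq_prod_def)

text \<open>
The inequalities say that \<open>k\<close> and the identity are contiguous from the parameters \<open>p\<close> to the
parameters \<open>q\<close>: for the scales \<open>fst\<close> this places \<open>A\<close> and its image in the same component, and for the
scales \<open>snd\<close> it makes the two maps on homology agree.
\<close>

lemma reeb_morphism_contiguous:
  fixes X :: "'a set"
  assumes X: "finite X" and UV: "U \<subseteq> V" and pq: "p \<le> q"
    and sym: "\<And>x y. d x y = d y x"
    and k: "respects_scales X d f p U k X d f q V"
    and near: "\<And>x x'. x \<in> X \<Longrightarrow> x' \<in> X \<Longrightarrow> (d x x' \<le> 2 * fst p \<longrightarrow> d x (k x') \<le> 2 * fst q) \<and>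
      (d x x' \<le> 2 * snd p \<longrightarrow> d x (k x') \<le> 2 * snd q)"
  shows "pvec_eq (reeb_ob X d f p U) (reeb_morphism k (pushforward X k) X d f q V)
    (reeb_morphism (\<lambda>x. x) (\<lambda>c :: 'a list \<Rightarrow> 'k::field. c) X d f q V)"
  unfolding pvec_eq_def
proof (intro ballI conjI)
  fix A assume "A \<in> idx (reeb_ob X d f p U)"
  then have A: "A \<in> pi0 (level_complex X d f (fst p) U)" by (simp add: idx_reeb_ob)
  let ?k = "reeb_morphism k (pushforward X k :: ('a list \<Rightarrow> 'k) \<Rightarrow> _) X d f q V"
    and ?i = "reeb_morphism (\<lambda>x. x) (\<lambda>c :: 'a list \<Rightarrow> 'k. c) X d f q V"
  note id = respects_scales_id[OF pq UV, of X d f]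
  note lift_k = lifts_to_chains_pushforward[OF X, of k] and lift_id = lifts_to_chains_id[of X]
  define C where "C = on_idx ?i A"
  have C: "C \<in> pi0 (level_complex X d f (fst q) V)" "A \<subseteq> C"
    using reeb_morphism_component[OF id A, of "\<lambda>c :: 'a list \<Rightarrow> 'k. c"] by (simp_all add: C_def)
  have AX: "A \<subseteq> X" using component_subset[OF A] by blast
  have "k x \<in> C" if "x \<in> A" for x
  proof (rule pi0_edge_closed[OF C(1)])
    show "x \<in> C" using that C(2) by blast
    \<comment> \<open>as \<open>{x}\<close> is a simplex at scale \<open>fst p\<close>, the bound \<open>near\<close> applies to the pair \<open>(x, x)\<close>\<close>
    have x: "x \<in> X" "f x \<in> U" "d x x \<le> 2 * fst p" using component_subset[OF A] that by blast+
    moreover have "d x x \<le> 2 * fst q" using x(3) pq by (simp add: less_eq_prod_def)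
    ultimately show "(x, k x) \<in> edges (level_complex X d f (fst q) V)"
      using k near[OF x(1) x(1)] UV sym[of x "k x"]
      unfolding edges_def level_complex_iff respects_scales_def by auto
  qed
  then have kAC: "k ` A \<subseteq> C" by blast
  moreover have "A \<noteq> {}" by (rule pi0_nonempty[OF hereditary_level_complex A])
  ultimately have "component_containing (level_complex X d f (fst q) V) (k ` A) = C"
    by (intro component_containing_eq hereditary_level_complex C(1)) simp_all
  then have idx: "on_idx ?k A = C" by (simp add: reeb_morphism_def Let_def)
  then show "on_idx ?k A = on_idx ?i A" by (simp add: C_def)
  fix v :: "nat \<Rightarrow> ('a list \<Rightarrow> 'k) set"
  assume "v \<in> carrier (fibre (reeb_ob X d f p U) A)"
  then have v: "v \<in> carrier (total_homology (VR A d (snd p)))" by (simp add: fibre_reeb_ob)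
  have "homology_map (pushforward X k) (VR C d (snd q)) v = homology_map (\<lambda>c. c) (VR C d (snd q)) v"
  proof (rule homology_map_cong[OF _ _ hereditary_VR _ v])
    show "chain_map (pushforward X k) (VR A d (snd p)) (VR C d (snd q))"
      by (rule chain_map_VR[OF k lift_k AX kAC])
    show "chain_map (\<lambda>c. c) (VR A d (snd p)) (VR C d (snd q))"
      using chain_map_VR[OF id lift_id AX] C(2) by simp
    fix n and c :: "'a list \<Rightarrow> 'k"
    assume c: "c \<in> cycles n (VR A d (snd p))"
    have sub: "\<sigma> \<subseteq> X" if "\<sigma> \<in> VR A d (snd p)" for \<sigma> using that AX unfolding VR_def by blast
    have "(\<lambda>ys. pushforward X k c ys - pushforward X (\<lambda>x. x) c ys) \<in> boundaries n (VR C d (snd q))"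
    proof (rule pushforward_contiguous_homologous[OF X sub c hereditary_VR])
      fix \<sigma> assume \<sigma>: "\<sigma> \<in> VR A d (snd p)"
      have dist: "d x x' \<le> 2 * snd q \<and> d x (k x') \<le> 2 * snd q \<and> d (k x') x \<le> 2 * snd q \<and>
          d (k x) (k x') \<le> 2 * snd q" if "x \<in> \<sigma>" "x' \<in> \<sigma>" for x x'
      proof -
        have x: "x \<in> X" "x' \<in> X" "d x x' \<le> 2 * snd p"
          using that \<sigma> AX unfolding VR_def by blast+
        then show ?thesis
          using near[OF x(1,2)] k pq sym[of x "k x'"] unfolding respects_scales_def
          by (auto simp: less_eq_prod_def)
      qed
      have "\<sigma> \<noteq> {}" "\<sigma> \<subseteq> A" using \<sigma> unfolding VR_def by blast+
      then show "\<sigma> \<noteq> {} \<and> (\<lambda>x. x) ` \<sigma> \<union> k ` \<sigma> \<in> VR C d (snd q)"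
        using dist \<open>\<And>x. x \<in> A \<Longrightarrow> k x \<in> C\<close> C(2) unfolding VR_def by (auto simp: subset_iff)
    qed
    moreover have "pushforward X (\<lambda>x. x) c = c"
      using support_subset_vertices[OF cycle_is_chain[OF c] sub] by (intro ext pushforward_id X) blast
    ultimately show "(\<lambda>ys. pushforward X k c ys - c ys) \<in> boundaries n (VR C d (snd q))" by simp
  qed
  then show "on_fibre ?k A v = on_fibre ?i A v"
    using idx by (simp add: reeb_morphism_def Let_def C_def)
qed

section \<open>Interleavings from maps of small distortion\<close>

text \<open>
For the nontrivial inclusion, move half of the way: the midpoint of \<open>t\<close> and \<open>v\<close> is at distance less
than \<open>\<epsilon>\<close> from both.
\<close>

lemma thicken_thicken:
  assumes "0 < \<epsilon>"
  shows "thicken \<epsilon> (thicken \<epsilon> U) = thicken (2 * \<epsilon>) U"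
proof
  show "thicken \<epsilon> (thicken \<epsilon> U) \<subseteq> thicken (2 * \<epsilon>) U"
    using assms by (force simp: thicken_def)
  show "thicken (2 * \<epsilon>) U \<subseteq> thicken \<epsilon> (thicken \<epsilon> U)"
  proof
    fix t assume "t \<in> thicken (2 * \<epsilon>) U"
    then obtain v where v: "v \<in> U" "\<bar>t - v\<bar> < 2 * \<epsilon>" using assms by (auto simp: thicken_def)
    define m where "m = (t + v) / 2"
    have "\<bar>t - m\<bar> < \<epsilon>" "\<bar>m - v\<bar> < \<epsilon>"
      using v(2) by (auto simp: m_def abs_less_iff field_simps)
    with v(1) show "t \<in> thicken \<epsilon> (thicken \<epsilon> U)"
      using assms unfolding thicken_def by auto
  qed
qed

lemma subset_thicken: "0 \<le> \<epsilon> \<Longrightarrow> U \<subseteq> thicken \<epsilon> U"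
  unfolding thicken_def by force

lemma thicken_mono: "U \<subseteq> V \<Longrightarrow> thicken \<epsilon> U \<subseteq> thicken \<epsilon> V"
  unfolding thicken_def by auto

text \<open>
What \<open>FunDist(\<Phi>, \<Psi>) < \<epsilon>\<close> says about individual points, with the pairs in the correspondence
distinguished according to whether they come from \<open>\<Phi>\<close> or from \<open>\<Psi>\<close>.
\<close>

definition distorts_less ::
    "real \<Rightarrow> 'a set \<Rightarrow> ('a \<Rightarrow> 'a \<Rightarrow> real) \<Rightarrow> ('a \<Rightarrow> real) \<Rightarrow>
     'b set \<Rightarrow> ('b \<Rightarrow> 'b \<Rightarrow> real) \<Rightarrow> ('b \<Rightarrow> real) \<Rightarrow> ('a \<Rightarrow> 'b) \<Rightarrow> ('b \<Rightarrow> 'a) \<Rightarrow> bool" where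
  "distorts_less \<epsilon> X dX f Y dY g \<Phi> \<Psi> \<longleftrightarrow>
     \<Phi> \<in> X \<rightarrow> Y \<and> \<Psi> \<in> Y \<rightarrow> X \<and>
     (\<forall>x\<in>X. \<forall>x'\<in>X. \<bar>dX x x' - dY (\<Phi> x) (\<Phi> x')\<bar> < 2 * \<epsilon>) \<and>
     (\<forall>y\<in>Y. \<forall>y'\<in>Y. \<bar>dX (\<Psi> y) (\<Psi> y') - dY y y'\<bar> < 2 * \<epsilon>) \<and>
     (\<forall>x\<in>X. \<forall>y\<in>Y. \<bar>dX x (\<Psi> y) - dY (\<Phi> x) y\<bar> < 2 * \<epsilon>) \<and>
     (\<forall>x\<in>X. \<bar>f x - g (\<Phi> x)\<bar> < \<epsilon>) \<and> (\<forall>y\<in>Y. \<bar>g y - f (\<Psi> y)\<bar> < \<epsilon>)"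

lemma distorts_less_sym:
  assumes "distorts_less \<epsilon> X dX f Y dY g \<Phi> \<Psi>"
    and "\<And>x x'. dX x x' = dX x' x" "\<And>y y'. dY y y' = dY y' y"
  shows "distorts_less \<epsilon> Y dY g X dX f \<Psi> \<Phi>"
proof -
  have "\<bar>dY y (\<Phi> x) - dX (\<Psi> y) x\<bar> < 2 * \<epsilon>" if "x \<in> X" "y \<in> Y" for x y
  proof -
    have "\<bar>dX x (\<Psi> y) - dY (\<Phi> x) y\<bar> < 2 * \<epsilon>"
      using assms(1) that unfolding distorts_less_def by blast
    then show ?thesis
      by (simp add: assms(2)[of "\<Psi> y"] assms(3)[of y] abs_minus_commute)
  qed
  then show ?thesis
    using assms(1) unfolding distorts_less_def by (simp add: abs_minus_commute)
qed

lemma distorts_less_respects_scales: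
  assumes d: "distorts_less \<epsilon> X dX f Y dY g \<Phi> \<Psi>" and \<epsilon>: "0 < \<epsilon>"
  shows "respects_scales X dX f p U \<Phi> Y dY g (p + (\<epsilon>, \<epsilon>)) (thicken \<epsilon> U)"
  unfolding respects_scales_def
proof (intro conjI ballI impI)
  fix x assume x: "x \<in> X"
  then show "\<Phi> x \<in> Y" using d unfolding distorts_less_def by blast
  show "g (\<Phi> x) \<in> thicken \<epsilon> U" if "f x \<in> U"
    using d x that \<epsilon> unfolding distorts_less_def thicken_def by (auto simp: abs_minus_commute)
  fix x' assume x': "x' \<in> X"
  have "\<bar>dX x x' - dY (\<Phi> x) (\<Phi> x')\<bar> < 2 * \<epsilon>"
    using d x x' unfolding distorts_less_def by blast
  then show "dX x x' \<le> 2 * fst p \<Longrightarrow> dY (\<Phi> x) (\<Phi> x') \<le> 2 * fst (p + (\<epsilon>, \<epsilon>))"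
    and "dX x x' \<le> 2 * snd p \<Longrightarrow> dY (\<Phi> x) (\<Phi> x') \<le> 2 * snd (p + (\<epsilon>, \<epsilon>))"
    by auto
qed

text \<open>
Both composites are the morphism induced by \<open>h\<close> from the parameters \<open>(p, U)\<close> to \<open>(q', V')\<close>.
\<close>

lemma reeb_morphism_square:
  assumes pq: "p \<le> q" "U \<subseteq> V" and pq': "p' \<le> q'" "U' \<subseteq> V'"
    and h: "respects_scales X dX f p U h Y dY g p' U'" and h': "respects_scales X dX f q V h Y dY g q' V'"
    and t: "lifts_to_chains X h t"
  shows "pvec_eq (reeb_ob X dX f p U)
    (reeb_map Y dY g q' V' \<circ>\<^sub>P reeb_morphism h t Y dY g p' U')
    (reeb_morphism h t Y dY g q' V' \<circ>\<^sub>P reeb_map X dX f q V)"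
proof -
  have id_comp: "(\<lambda>x. x) \<circ> h = h" "h \<circ> (\<lambda>x. x) = h" "(\<lambda>c. c) \<circ> t = t" "t \<circ> (\<lambda>c. c) = t"
    by (simp_all add: comp_def)
  note l = reeb_morphism_comp[OF h t respects_scales_id[OF pq'] lifts_to_chains_id, unfolded id_comp]
    and r = reeb_morphism_comp[OF respects_scales_id[OF pq] lifts_to_chains_id h' t, unfolded id_comp]
  show ?thesis
    unfolding reeb_map_eq_reeb_morphism by (rule pvec_eq_trans[OF l pvec_eq_sym[OF r]])
qed

lemma pers_nat_trans_reeb_morphism:
  assumes X: "finite X" and \<epsilon>: "0 < \<epsilon>" and d: "distorts_less \<epsilon> X dX f Y dY g \<Phi> \<Psi>"
  shows "pers_nat_trans (decorated_reeb X dX f) (smoothing \<epsilon> (decorated_reeb Y dY g))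
    (\<lambda>p U. reeb_morphism \<Phi> (pushforward X \<Phi>) Y dY g (p + (\<epsilon>, \<epsilon>)) (thicken \<epsilon> U))"
proof -
  note lift = lifts_to_chains_pushforward[OF X, of \<Phi>]
  have ne: "respects_scales X dX f (a, b) U \<Phi> Y dY g (a + \<epsilon>, b + \<epsilon>) (thicken \<epsilon> U)" for a b U
    using distorts_less_respects_scales[OF d \<epsilon>, of "(a, b)"] by simp
  show ?thesis
    unfolding pers_nat_trans_def opens_nat_trans_def decorated_reeb_def smoothing_def
    by (auto intro!: reeb_morphism_hom reeb_morphism_square ne lift thicken_mono add_right_mono)
qed

text \<open>
By functoriality the composite is induced by \<open>\<Psi> \<circ> \<Phi>\<close>, which is contiguous to the identity at
parameters shifted by \<open>2\<epsilon>\<close>, since it distorts \<open>d(x, x')\<close> by less than \<open>4\<epsilon>\<close> in one argument.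
\<close>

lemma interleaving_triangle:
  fixes X :: "'a set" and Y :: "'b set"
  assumes X: "finite X" and Y: "finite Y" and \<epsilon>: "0 < \<epsilon>"
    and sym: "\<And>x x'. dX x x' = dX x' x"
    and d: "distorts_less \<epsilon> X dX f Y dY g \<Phi> \<Psi>" and d': "distorts_less \<epsilon> Y dY g X dX f \<Psi> \<Phi>"
  shows "pvec_eq (reeb_ob X dX f p U)
    (reeb_morphism \<Psi> (pushforward Y \<Psi>) X dX f (p + (\<epsilon>, \<epsilon>) + (\<epsilon>, \<epsilon>)) (thicken \<epsilon> (thicken \<epsilon> U))
       \<circ>\<^sub>P reeb_morphism \<Phi> (pushforward X \<Phi> :: ('a list \<Rightarrow> 'k::field) \<Rightarrow> _) Y dY g (p + (\<epsilon>, \<epsilon>)) (thicken \<epsilon> U))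
    (smoothing_unit (2 * \<epsilon>) (decorated_reeb X dX f) p U)"
proof -
  let ?q = "p + (2 * \<epsilon>, 2 * \<epsilon>)" and ?V = "thicken (2 * \<epsilon>) U"
  have q: "p + (\<epsilon>, \<epsilon>) + (\<epsilon>, \<epsilon>) = ?q" by (simp add: prod_eq_iff)
  have le: "p \<le> ?q" "U \<subseteq> ?V" using \<epsilon> subset_thicken[of "2 * \<epsilon>" U] by (simp_all add: less_eq_prod_def)
  let ?\<Phi> = "reeb_morphism \<Phi> (pushforward X \<Phi> :: ('a list \<Rightarrow> 'k) \<Rightarrow> _) Y dY g (p + (\<epsilon>, \<epsilon>)) (thicken \<epsilon> U)"
    and ?k = "reeb_morphism (\<Psi> \<circ> \<Phi>) (pushforward X (\<Psi> \<circ> \<Phi>) :: ('a list \<Rightarrow> 'k) \<Rightarrow> _) X dX f ?q ?V"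
    and ?i = "reeb_morphism (\<lambda>x. x) (\<lambda>c :: 'a list \<Rightarrow> 'k. c) X dX f ?q ?V"
  note \<Phi> = distorts_less_respects_scales[OF d \<epsilon>, of p U]
    and \<Psi> = distorts_less_respects_scales[OF d' \<epsilon>, of "p + (\<epsilon>, \<epsilon>)" "thicken \<epsilon> U",
      unfolded q thicken_thicken[OF \<epsilon>]]
  have pushforward_comp: "pushforward Y \<Psi> \<circ> pushforward X \<Phi> = (pushforward X (\<Psi> \<circ> \<Phi>) :: ('a list \<Rightarrow> 'k) \<Rightarrow> _)"
    using d X Y unfolding distorts_less_def
    by (intro ext) (simp add: pushforward_pushforward image_subset_iff Pi_iff comp_def)
  have comp: "pvec_eq (reeb_ob X dX f p U)
    (reeb_morphism \<Psi> (pushforward Y \<Psi>) X dX f ?q ?V \<circ>\<^sub>P ?\<Phi>) ?k"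
    unfolding pushforward_comp[symmetric]
    by (rule reeb_morphism_comp[OF \<Phi> lifts_to_chains_pushforward[OF X] \<Psi> lifts_to_chains_pushforward[OF Y]])
  have near: "dX x ((\<Psi> \<circ> \<Phi>) x') < dX x x' + 4 * \<epsilon>" if "x \<in> X" "x' \<in> X" for x x'
  proof -
    have "\<Phi> x' \<in> Y" using d that unfolding distorts_less_def by blast
    then have "\<bar>dX x (\<Psi> (\<Phi> x')) - dY (\<Phi> x) (\<Phi> x')\<bar> < 2 * \<epsilon>"
      "\<bar>dX x x' - dY (\<Phi> x) (\<Phi> x')\<bar> < 2 * \<epsilon>"
      using d that unfolding distorts_less_def by blast+
    then show ?thesis by (simp add: abs_less_iff)
  qed
  have "pvec_eq (reeb_ob X dX f p U) ?k ?i"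
    using near by (intro reeb_morphism_contiguous X le sym respects_scales_comp[OF \<Phi> \<Psi>]) fastforce+
  moreover have "pvec_eq (reeb_ob X dX f p U) (reeb_map X dX f ?q ?V \<circ>\<^sub>P reeb_map X dX f p ?V) ?i"
    unfolding reeb_map_eq_reeb_morphism
    by (rule reeb_morphism_comp[OF respects_scales_id[OF order_refl le(2)] lifts_to_chains_id
        respects_scales_id[OF le(1) order_refl] lifts_to_chains_id, unfolded comp_def])
  ultimately have "pvec_eq (reeb_ob X dX f p U)
      (reeb_morphism \<Psi> (pushforward Y \<Psi>) X dX f ?q ?V \<circ>\<^sub>P ?\<Phi>) (reeb_map X dX f ?q ?V \<circ>\<^sub>P reeb_map X dX f p ?V)"
    using comp unfolding pvec_eq_def by simp
  then show ?thesis
    unfolding q thicken_thicken[OF \<epsilon>] smoothing_unit_def decorated_reeb_def by simp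
qed

lemma interleaved_decorated_reeb:
  assumes X: "finite X" and Y: "finite Y" and \<epsilon>: "0 < \<epsilon>"
    and sym: "\<And>x x'. dX x x' = dX x' x" "\<And>y y'. dY y y' = dY y' y"
    and d: "distorts_less \<epsilon> X dX f Y dY g \<Phi> \<Psi>"
  shows "interleaved \<epsilon> (decorated_reeb X dX f :: ('a, 'k::field) reeb_functor) (decorated_reeb Y dY g)"
proof -
  note d' = distorts_less_sym[OF d sym]
  let ?\<phi> = "\<lambda>p U. reeb_morphism \<Phi> (pushforward X \<Phi> :: ('a list \<Rightarrow> 'k) \<Rightarrow> _) Y dY g (p + (\<epsilon>, \<epsilon>)) (thicken \<epsilon> U)"
    and ?\<psi> = "\<lambda>p U. reeb_morphism \<Psi> (pushforward Y \<Psi> :: ('b list \<Rightarrow> 'k) \<Rightarrow> _) X dX f (p + (\<epsilon>, \<epsilon>)) (thicken \<epsilon> U)"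
  have ob: "oob (pob (decorated_reeb X dX f) p) U = reeb_ob X dX f p U" for X dX f p U
    by (simp add: decorated_reeb_def)
  show ?thesis
    unfolding interleaved_def
  proof (intro exI[of _ ?\<phi>] exI[of _ ?\<psi>] conjI allI impI)
    show "pers_nat_trans (decorated_reeb X dX f) (smoothing \<epsilon> (decorated_reeb Y dY g)) ?\<phi>"
      by (rule pers_nat_trans_reeb_morphism[OF X \<epsilon> d])
    show "pers_nat_trans (decorated_reeb Y dY g) (smoothing \<epsilon> (decorated_reeb X dX f)) ?\<psi>"
      by (rule pers_nat_trans_reeb_morphism[OF Y \<epsilon> d'])
    fix p :: "real \<times> real" and U :: "real set"
    show "pvec_eq (oob (pob (decorated_reeb X dX f) p) U) (smoothing_trans \<epsilon> ?\<psi> p U \<circ>\<^sub>P ?\<phi> p U)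
        (smoothing_unit (2 * \<epsilon>) (decorated_reeb X dX f) p U)"
      unfolding ob smoothing_trans_def by (rule interleaving_triangle[OF X Y \<epsilon> sym(1) d d'])
    show "pvec_eq (oob (pob (decorated_reeb Y dY g) p) U) (smoothing_trans \<epsilon> ?\<phi> p U \<circ>\<^sub>P ?\<psi> p U)
        (smoothing_unit (2 * \<epsilon>) (decorated_reeb Y dY g) p U)"
      unfolding ob smoothing_trans_def by (rule interleaving_triangle[OF Y X \<epsilon> sym(2) d' d])
  qed
qed

lemma sup_norm_on_less:
  assumes "sup_norm_on Z h < ennreal \<epsilon>" "z \<in> Z"
  shows "\<bar>h z\<bar> < \<epsilon>"
proof -
  have "ennreal \<bar>h z\<bar> \<le> sup_norm_on Z h" unfolding sup_norm_on_def using assms(2) by (rule SUP_upper)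
  also note assms(1)
  finally show ?thesis by (simp add: ennreal_less_iff)
qed

lemma fun_dist_less_imp_distorts_less:
  assumes \<Phi>: "\<Phi> \<in> X \<rightarrow> Y" and \<Psi>: "\<Psi> \<in> Y \<rightarrow> X"
    and \<epsilon>: "0 < \<epsilon>" "fun_dist X dX f Y dY g \<Phi> \<Psi> < ennreal \<epsilon>"
  shows "distorts_less \<epsilon> X dX f Y dY g \<Phi> \<Psi>"
proof -
  have half: "distortion X dX Y dY \<Phi> \<Psi> / 2 < ennreal \<epsilon>"
    and sup: "sup_norm_on X (\<lambda>x. f x - g (\<Phi> x)) < ennreal \<epsilon>"
      "sup_norm_on Y (\<lambda>y. g y - f (\<Psi> y)) < ennreal \<epsilon>"
    using \<epsilon>(2) by (simp_all add: fun_dist_def)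
  have dist: "distortion X dX Y dY \<Phi> \<Psi> < ennreal (2 * \<epsilon>)"
  proof (rule ccontr)
    assume "\<not> distortion X dX Y dY \<Phi> \<Psi> < ennreal (2 * \<epsilon>)"
    then have "ennreal (2 * \<epsilon>) / 2 \<le> distortion X dX Y dY \<Phi> \<Psi> / 2"
      by (intro divide_right_mono_ennreal) simp
    also note half
    finally show False using \<epsilon>(1) by (simp add: ennreal_divide_numeral)
  qed
  have C: "\<bar>dX x x' - dY y y'\<bar> < 2 * \<epsilon>"
    if "(x, y) \<in> correspondence X Y \<Phi> \<Psi>" "(x', y') \<in> correspondence X Y \<Phi> \<Psi>" for x y x' y'
  proof -
    have "ennreal \<bar>dX x x' - dY y y'\<bar> \<le> distortion X dX Y dY \<Phi> \<Psi>"
      unfolding distortion_def using that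
      by (intro SUP_upper2[of "((x, y), (x', y'))"]) auto
    also note dist
    finally show ?thesis using \<epsilon>(1) by (simp add: ennreal_less_iff)
  qed
  show ?thesis
    unfolding distorts_less_def
  proof (intro conjI ballI)
    show "\<bar>f x - g (\<Phi> x)\<bar> < \<epsilon>" if "x \<in> X" for x by (rule sup_norm_on_less[OF sup(1) that])
    show "\<bar>g y - f (\<Psi> y)\<bar> < \<epsilon>" if "y \<in> Y" for y by (rule sup_norm_on_less[OF sup(2) that])
  qed (use \<Phi> \<Psi> in \<open>auto intro!: C simp: correspondence_def\<close>)
qed

theorem theorem4p7:
  fixes X :: "'a set" and dX :: "'a \<Rightarrow> 'a \<Rightarrow> real" and f :: "'a \<Rightarrow> real"
    and Y :: "'b set" and dY :: "'b \<Rightarrow> 'b \<Rightarrow> real" and g :: "'b \<Rightarrow> real"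
    and DF :: "('a, 'k::field) reeb_functor" and DG :: "('b, 'k) reeb_functor"
  assumes "Metric_space X dX" and "finite X"
    and "Metric_space Y dY" and "finite Y"
    and "DF = decorated_reeb X dX f"
    and "DG = decorated_reeb Y dY g"
  shows "interleaving_distance DF DG \<le> functional_distortion_distance X dX f Y dY g"
  unfolding functional_distortion_distance_def
proof (rule INF_greatest, clarify)
  fix \<Phi> \<Psi>
  assume \<Phi>\<Psi>: "\<Phi> \<in> X \<rightarrow> Y" "\<Psi> \<in> Y \<rightarrow> X"
  have sym: "dX x x' = dX x' x" "dY y y' = dY y' y" for x x' y y'
    using assms(1,3) by (simp_all add: Metric_space.commute)
  show "interleaving_distance DF DG \<le> fun_dist X dX f Y dY g \<Phi> \<Psi>"
  proof (rule dense_ge)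
    fix z assume z: "fun_dist X dX f Y dY g \<Phi> \<Psi> < z"
    show "interleaving_distance DF DG \<le> z"
    proof (cases z)
      case (real \<epsilon>)
      with z have \<epsilon>: "0 < \<epsilon>" by (cases "\<epsilon> = 0") auto
      have "interleaved \<epsilon> DF DG"
        unfolding assms(5,6)
        using fun_dist_less_imp_distorts_less[OF \<Phi>\<Psi> \<epsilon>] z real
        by (intro interleaved_decorated_reeb assms(2,4) \<epsilon> sym) simp
      then show ?thesis
        using \<epsilon> unfolding interleaving_distance_def real by (intro INF_lower) simp
    qed simp
  qed
qed

end
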